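(* Let $H$ be a Fréchet–Hilbert space and let $u_1,u_2\colon\mathcal{S}\to H$ be continuous linear maps. Then for all $k,m,n\in\mathbb{N}$ and $x_1,\dots,x_m,y_1,\dots,y_m\in\mathcal{S}$, \[\Big|\sum_{j=1}^m\langle u_1(x_j),u_2(y_j)\rangle_k\Big|\leqslant K\|u_1\|_{n,k}\,\|u_2\|_{n,k}\,\|(x_j)\|_{2n+1}^{rc}\,\|(y_j)\|_{2n+1}^{rc}.\] Equivalently, for any $k,n\in\mathbb{N}$ there are $(2n+1)$-states $\phi_1,\phi_2,\psi_1,\psi_2$ on $\mathcal{S}$ such that for all $x,y\in\mathcal{S}$, \[|\langle u_1(x),u_2(y)\rangle_k|\leqslant K\|u_1\|_{n,k}\|u_2\|_{n,k}\big(\phi_1(x^*x)+\phi_2(xx^* )\big)^{1/2}\big(\psi_1(y^*y)+\psi_2(yy^* )\big)^{1/2}.\]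
   Context: Let $\mathbb{N}=\{1,2,\dots\}$. Let $s$ be the space of complex sequences $\xi=(\xi_j)_{j\geqslant1}$ with $|\xi|_n:=(\sum_{j}|\xi_j|^2j^{2n})^{1/2}<\infty$ for all $n\in\mathbb{N}$, and let $s'$ be its dual, the space of sequences $\eta$ with $|\eta|_n':=(\sum_j|\eta_j|^2j^{-2n})^{1/2}<\infty$ for some $n$, with pairing $\langle\xi,\eta\rangle=\sum_j\xi_j\overline{\eta_j}$. The noncommutative Schwartz space $\mathcal{S}=L(s',s)$ is the Fréchet space of continuous linear operators $s'\to s$ with the topology of uniform convergence on bounded sets; it is a $*$-algebra with product $xy:=x\circ\iota\circ y$ ($\iota\colon s\hookrightarrow s'$ the inclusion) and involution given by $\langle x^*\xi,\eta\rangle=\langle\xi,x\eta\rangle$; $\mathcal{S}'$ is its dual. For $n\in\mathbb{N}$, $\|x\|_n:=\sup\{|x\xi|_n\colon \xi\in s',\ |\xi|_n'\leqslant1\}$, and $\|u\|_n^*:=\sup\{|u(x,y)|\colon\|x\|_n\leqslant1,\|y\|_n\leqslant1\}$ for bilinear $u$. For $x_1,\dots,x_m\in\mathcal{S}$, $\|(x_j)\|_k^{rc}:=\max\{\|\sum_jx_j^*x_j\|_k^{1/2},\|\sum_jx_jx_j^*\|_k^{1/2}\}$. A Fréchet–Hilbert space $H$ is a Fréchet space whose topology is given by a non-decreasing sequence of seminorms $\|\cdot\|_k$ induced by semi-inner products $\langle\cdot,\cdot\rangle_k$. For a linear map $T\colon\mathcal{S}\to H$, $\|T\|_{n,k}:=\sup\{\|Tx\|_k\colon\|x\|_n\leqslant1\}$.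 For $\xi\in s'$ with $|\xi|_n'\leqslant1$ let $\phi_\xi(x)=\langle x\xi,\xi\rangle$; an $n$-state on $\mathcal{S}$ is an element of the closed convex hull in $\mathcal{S}'$ of $\{\phi_\xi\colon |\xi|_n'\leqslant1\}$. For $n\in\mathbb{N}$, $K_n$ denotes the smallest constant such that $|\sum_{j=1}^mu(x_j,y_j)|\leqslant K_n\|u\|_n^*\|(x_j)\|_{2n+1}^{rc}\|(y_j)\|_{2n+1}^{rc}$ for all continuous bilinear forms $u$ on $\mathcal{S}\times\mathcal{S}$, all $m$ and all $x_j,y_j\in\mathcal{S}$; and $K:=\sup_nK_n$ (which satisfies $K\leqslant\pi^2/6$). *)

theory Defs
  imports Complex_Main "HOL-Library.Extended_Real"
begin

(* Sequences xi = (xi_j)_{j>=1} are represented as functions nat => complex,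
   with position i :: nat standing for the index j = i + 1. *)
type_synonym seqc = "nat \<Rightarrow> complex"
type_synonym opS = "seqc \<Rightarrow> seqc"

definition wt :: "nat \<Rightarrow> real" where "wt i = real (Suc i)"

definition snorm :: "nat \<Rightarrow> seqc \<Rightarrow> real" where
  "snorm n \<xi> = sqrt (\<Sum>i. (cmod (\<xi> i))\<^sup>2 * wt i ^ (2*n))"
definition dnorm :: "nat \<Rightarrow> seqc \<Rightarrow> real" where
  "dnorm n \<xi> = sqrt (\<Sum>i. (cmod (\<xi> i))\<^sup>2 / wt i ^ (2*n))"

definition s_space :: "seqc set" where
  "s_space = {\<xi>. \<forall>n\<ge>1. summable (\<lambda>i. (cmod (\<xi> i))\<^sup>2 * wt i ^ (2*n))}"
definition s'_space :: "seqc set" where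
  "s'_space = {\<xi>. \<exists>n\<ge>1. summable (\<lambda>i. (cmod (\<xi> i))\<^sup>2 / wt i ^ (2*n))}"

definition dball :: "nat \<Rightarrow> seqc set" where
  "dball n = {\<xi>. summable (\<lambda>i. (cmod (\<xi> i))\<^sup>2 / wt i ^ (2*n)) \<and> dnorm n \<xi> \<le> 1}"

definition pair :: "seqc \<Rightarrow> seqc \<Rightarrow> complex" where
  "pair \<xi> \<eta> = (\<Sum>i. \<xi> i * cnj (\<eta> i))"

definition opn :: "nat \<Rightarrow> opS \<Rightarrow> real" where
  "opn n x = Sup ((\<lambda>\<xi>. snorm n (x \<xi>)) ` dball n)"

(* The noncommutative Schwartz space S = L(s', s): linear maps s' -> s, continuous
   (s' carries the inductive-limit/strong dual topology, so continuity means that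
   ||x||_n < infinity for all n). Operators are taken to be 0 outside s' so that
   they are determined by their action on s'. *)
definition S_space :: "opS set" where
  "S_space = {x. (\<forall>\<xi>\<in>s'_space. x \<xi> \<in> s_space)
     \<and> (\<forall>\<xi>. \<xi> \<notin> s'_space \<longrightarrow> x \<xi> = (\<lambda>i. 0))
     \<and> (\<forall>\<xi>\<in>s'_space. \<forall>\<eta>\<in>s'_space. x (\<lambda>i. \<xi> i + \<eta> i) = (\<lambda>i. x \<xi> i + x \<eta> i))
     \<and> (\<forall>\<xi>\<in>s'_space. \<forall>c. x (\<lambda>i. c * \<xi> i) = (\<lambda>i. c * x \<xi> i))
     \<and> (\<forall>n\<ge>1. bdd_above ((\<lambda>\<xi>. snorm n (x \<xi>)) ` dball n))}"

definition addS :: "opS \<Rightarrow> opS \<Rightarrow> opS" where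
  "addS x y = (\<lambda>\<xi> i. x \<xi> i + y \<xi> i)"
definition smulS :: "complex \<Rightarrow> opS \<Rightarrow> opS" where
  "smulS c x = (\<lambda>\<xi> i. c * x \<xi> i)"
definition sumS :: "(nat \<Rightarrow> opS) \<Rightarrow> nat \<Rightarrow> opS" where
  "sumS f m = (\<lambda>\<xi> i. \<Sum>j<m. f j \<xi> i)"

definition mulS :: "opS \<Rightarrow> opS \<Rightarrow> opS" where
  "mulS x y = x \<circ> y"

definition adjS :: "opS \<Rightarrow> opS" where
  "adjS x = (THE y. y \<in> S_space \<and>
      (\<forall>\<xi>\<in>s'_space. \<forall>\<eta>\<in>s'_space. pair (y \<xi>) \<eta> = pair \<xi> (x \<eta>)))"

definition rcnorm :: "nat \<Rightarrow> (nat \<Rightarrow> opS) \<Rightarrow> nat \<Rightarrow> real" where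
  "rcnorm k xs m = max (sqrt (opn k (sumS (\<lambda>j. mulS (adjS (xs j)) (xs j)) m)))
                       (sqrt (opn k (sumS (\<lambda>j. mulS (xs j) (adjS (xs j))) m)))"

(* continuous bilinear forms on S x S (S is Frechet with the norms ||.||_n) *)
definition cont_bilinear :: "(opS \<Rightarrow> opS \<Rightarrow> complex) \<Rightarrow> bool" where
  "cont_bilinear u \<longleftrightarrow>
     (\<forall>x\<in>S_space. \<forall>x'\<in>S_space. \<forall>y\<in>S_space. u (addS x x') y = u x y + u x' y)
   \<and> (\<forall>x\<in>S_space. \<forall>y\<in>S_space. \<forall>y'\<in>S_space. u x (addS y y') = u x y + u x y')
   \<and> (\<forall>x\<in>S_space. \<forall>y\<in>S_space. \<forall>c. u (smulS c x) y = c * u x y \<and> u x (smulS c y) = c * u x y)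
   \<and> (\<exists>n\<ge>1. \<exists>C. \<forall>x\<in>S_space. \<forall>y\<in>S_space. cmod (u x y) \<le> C * opn n x * opn n y)"

definition bnorm :: "nat \<Rightarrow> (opS \<Rightarrow> opS \<Rightarrow> complex) \<Rightarrow> ereal" where
  "bnorm n u = (SUP xy \<in> {(x, y). x \<in> S_space \<and> y \<in> S_space \<and> opn n x \<le> 1 \<and> opn n y \<le> 1}.
                   ereal (cmod (u (fst xy) (snd xy))))"

(* K_n: the smallest constant in the noncommutative Grothendieck-type inequality *)
definition Kn :: "nat \<Rightarrow> real" where
  "Kn n = Inf {C. 0 \<le> C \<and> (\<forall>u. cont_bilinear u \<longrightarrow> (\<forall>m xs ys.
      (\<forall>j<m. xs j \<in> S_space \<and> ys j \<in> S_space) \<longrightarrow>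
      ereal (cmod (\<Sum>j<m. u (xs j) (ys j)))
        \<le> ereal C * bnorm n u * ereal (rcnorm (2*n+1) xs m) * ereal (rcnorm (2*n+1) ys m)))}"

definition K :: real where "K = Sup (Kn ` {1..})"

definition hnorm :: "(nat \<Rightarrow> 'h \<Rightarrow> 'h \<Rightarrow> complex) \<Rightarrow> nat \<Rightarrow> 'h \<Rightarrow> real" where
  "hnorm ip k a = sqrt (Re (ip k a a))"

definition frechet_hilbert ::
  "(complex \<Rightarrow> 'h::ab_group_add \<Rightarrow> 'h) \<Rightarrow> (nat \<Rightarrow> 'h \<Rightarrow> 'h \<Rightarrow> complex) \<Rightarrow> bool" where
  "frechet_hilbert smul ip \<longleftrightarrow>
     (\<forall>a b x. smul a (x + b) = smul a x + smul a b)
   \<and> (\<forall>a b x. smul (a + b) x = smul a x + smul b x)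
   \<and> (\<forall>a b x. smul (a * b) x = smul a (smul b x))
   \<and> (\<forall>x. smul 1 x = x)
   \<and> (\<forall>k a b c. ip k (a + b) c = ip k a c + ip k b c)
   \<and> (\<forall>k c a b. ip k (smul c a) b = c * ip k a b)
   \<and> (\<forall>k a b. ip k b a = cnj (ip k a b))
   \<and> (\<forall>k a. 0 \<le> Re (ip k a a))
   \<and> (\<forall>k a. hnorm ip k a \<le> hnorm ip (Suc k) a)
   \<and> (\<forall>a. (\<forall>k. hnorm ip k a = 0) \<longrightarrow> a = 0)
   \<and> (\<forall>f::nat \<Rightarrow> 'h. (\<forall>k. \<forall>e>0. \<exists>N. \<forall>p\<ge>N. \<forall>q\<ge>N. hnorm ip k (f p - f q) < e) \<longrightarrow>
        (\<exists>a. \<forall>k. (\<lambda>p. hnorm ip k (f p - a)) \<longlonglongrightarrow> 0))"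

definition cont_linear_S ::
  "(complex \<Rightarrow> 'h::ab_group_add \<Rightarrow> 'h) \<Rightarrow> (nat \<Rightarrow> 'h \<Rightarrow> 'h \<Rightarrow> complex) \<Rightarrow> (opS \<Rightarrow> 'h) \<Rightarrow> bool" where
  "cont_linear_S smul ip u \<longleftrightarrow>
     (\<forall>x\<in>S_space. \<forall>y\<in>S_space. u (addS x y) = u x + u y)
   \<and> (\<forall>x\<in>S_space. \<forall>c. u (smulS c x) = smul c (u x))
   \<and> (\<forall>k. \<exists>n\<ge>1. \<exists>C. \<forall>x\<in>S_space. hnorm ip k (u x) \<le> C * opn n x)"

definition opnormH :: "(nat \<Rightarrow> 'h \<Rightarrow> 'h \<Rightarrow> complex) \<Rightarrow> (opS \<Rightarrow> 'h) \<Rightarrow> nat \<Rightarrow> nat \<Rightarrow> ereal" where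
  "opnormH ip T n k = (SUP x \<in> {x \<in> S_space. opn n x \<le> 1}. ereal (hnorm ip k (T x)))"

definition dual_S :: "(opS \<Rightarrow> complex) \<Rightarrow> bool" where
  "dual_S \<phi> \<longleftrightarrow>
     (\<forall>x\<in>S_space. \<forall>y\<in>S_space. \<phi> (addS x y) = \<phi> x + \<phi> y)
   \<and> (\<forall>x\<in>S_space. \<forall>c. \<phi> (smulS c x) = c * \<phi> x)
   \<and> (\<exists>n\<ge>1. \<exists>C. \<forall>x\<in>S_space. cmod (\<phi> x) \<le> C * opn n x)"

definition phiv :: "seqc \<Rightarrow> opS \<Rightarrow> complex" where
  "phiv \<xi> x = pair (x \<xi>) \<xi>"

(* n-states: elements of the weak*-closed convex hull in S' of {phi_xi : |xi|'_n <= 1};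
   weak*-closure = closure for pointwise convergence on S *)
definition nstate :: "nat \<Rightarrow> (opS \<Rightarrow> complex) \<Rightarrow> bool" where
  "nstate n \<phi> \<longleftrightarrow> dual_S \<phi> \<and>
     (\<forall>F. finite F \<and> F \<subseteq> S_space \<longrightarrow> (\<forall>e>0. \<exists>p (a::nat \<Rightarrow> real) (\<xi>s::nat \<Rightarrow> seqc).
        (\<forall>i<p. 0 \<le> a i \<and> \<xi>s i \<in> dball n) \<and> (\<Sum>i<p. a i) = 1 \<and>
        (\<forall>x\<in>F. cmod (\<phi> x - (\<Sum>i<p. complex_of_real (a i) * phiv (\<xi>s i) x)) < e)))"

end

theory Submission
  imports Defs "HOL-Analysis.L2_Norm"
begin

text \<open>
  Let \<open>\<Phi>(x) = \<Sum>\<^sub>k (2k\<^sup>2)\<^sup>-\<^sup>1 k\<^bsup>4n+2\<^esup> x\<^sub>k\<^sub>k\<close>, which is a \<open>(2n+1)\<close>-state because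
  \<open>\<Sum>\<^sub>k (2k\<^sup>2)\<^sup>-\<^sup>1 \<le> 1\<close> and because \<open>k\<^bsup>2n+1\<^esup> e\<^sub>k\<close> lies in the dual unit ball. Bounding the
  operator norm of the matrix \<open>(i\<^sup>n x\<^sub>i\<^sub>k k\<^sup>n)\<close> by its Hilbert--Schmidt norm and using
  \<open>2 i\<^bsup>2n\<^esup> k\<^bsup>2n\<^esup> \<le> i\<^bsup>4n\<^esup> + k\<^bsup>4n\<^esup>\<close> gives \<open>\<parallel>x\<parallel>\<^sub>n\<^sup>2 \<le> \<Phi>(x\<^sup>*x) + \<Phi>(xx\<^sup>*)\<close>.
  Summed over a family and combined with Cauchy--Schwarz, this gives \<open>K\<^sub>n \<le> 2\<close>, so \<open>K\<close> is a
  genuine supremum and the Grothendieck inequality holds with it. The bilinear form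
  \<open>u(x, y) = \<langle>u\<^sub>1(x), u\<^sub>2(y\<^sup>*)\<rangle>\<^sub>k\<close> then yields the first claim. For a single pair \<open>x, y\<close> the same
  estimate holds with constant \<open>1 \<le> K\<close>, so all four states in the second claim can be \<open>\<Phi>\<close>
  and no separation argument is needed.
\<close>

section \<open>Weighted sequence spaces\<close>

lemma wt_pos [simp]: "0 < wt i" and wt_nonneg [simp]: "0 \<le> wt i" and wt_ge_1 [simp]: "1 \<le> wt i"
  and wt_nonzero [simp]: "wt i \<noteq> 0"
  by (auto simp: wt_def)

text \<open>\<open>snorm\<close> and \<open>dnorm\<close> are built on \<open>suminf\<close>, which
  is informative only for summable series. Every norm estimate therefore travels with one of these
  two predicates.\<close>

definition s_summable :: "nat \<Rightarrow> seqc \<Rightarrow> bool" where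
  "s_summable n \<xi> \<longleftrightarrow> summable (\<lambda>i. (cmod (\<xi> i))\<^sup>2 * wt i ^ (2*n))"
definition d_summable :: "nat \<Rightarrow> seqc \<Rightarrow> bool" where
  "d_summable n \<xi> \<longleftrightarrow> summable (\<lambda>i. (cmod (\<xi> i))\<^sup>2 / wt i ^ (2*n))"

lemma s_space_iff: "\<xi> \<in> s_space \<longleftrightarrow> (\<forall>n\<ge>1. s_summable n \<xi>)"
  by (simp add: s_space_def s_summable_def)

lemma s'_space_iff: "\<xi> \<in> s'_space \<longleftrightarrow> (\<exists>n\<ge>1. d_summable n \<xi>)"
  by (simp add: s'_space_def d_summable_def)

lemma dball_iff: "\<xi> \<in> dball n \<longleftrightarrow> d_summable n \<xi> \<and> dnorm n \<xi> \<le> 1"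
  by (simp add: dball_def d_summable_def)

lemma s_summable_mono:
  assumes "s_summable n \<xi>" "m \<le> n"
  shows "s_summable m \<xi>"
  unfolding s_summable_def
  by (rule summable_comparison_test'[OF assms(1)[unfolded s_summable_def], of 0])
     (use assms(2) in \<open>auto intro!: mult_left_mono power_increasing\<close>)

lemma d_summable_mono:
  assumes "d_summable n \<xi>" "n \<le> m"
  shows "d_summable m \<xi>"
  unfolding d_summable_def
  by (rule summable_comparison_test'[OF assms(1)[unfolded d_summable_def], of 0])
     (use assms(2) in \<open>auto intro!: divide_left_mono power_increasing\<close>)

text \<open>Since every weight w is at least 1, w^(-2m) <= 1 <= w^(2n) holds termwise. The inclusion
  of s into s' is thus contractive for every pair of indices, which is what makes products of
  operators bounded.\<close>

lemma s_summable_imp_d_summable: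
  assumes "s_summable n \<xi>"
  shows "d_summable m \<xi>" "dnorm m \<xi> \<le> snorm n \<xi>"
proof -
  have le: "(cmod (\<xi> i))\<^sup>2 / wt i ^ (2*m) \<le> (cmod (\<xi> i))\<^sup>2 * wt i ^ (2*n)" for i
  proof -
    have "(cmod (\<xi> i))\<^sup>2 / wt i ^ (2*m) \<le> (cmod (\<xi> i))\<^sup>2 / 1"
      by (rule divide_left_mono) auto
    also have "\<dots> \<le> (cmod (\<xi> i))\<^sup>2 * wt i ^ (2*n)"
      using mult_left_mono[of 1 "wt i ^ (2*n)" "(cmod (\<xi> i))\<^sup>2"] by simp
    finally show ?thesis .
  qed
  show 1: "d_summable m \<xi>"
    unfolding d_summable_def
    by (rule summable_comparison_test'[OF assms[unfolded s_summable_def], of 0]) (use le in auto)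
  show "dnorm m \<xi> \<le> snorm n \<xi>"
    unfolding dnorm_def snorm_def
    by (intro real_sqrt_le_mono suminf_le le)
       (use 1 assms in \<open>auto simp: d_summable_def s_summable_def\<close>)
qed

lemma d_summable_s': "1 \<le> n \<Longrightarrow> d_summable n \<xi> \<Longrightarrow> \<xi> \<in> s'_space"
  by (auto simp: s'_space_iff)

lemma s_subset_s': "\<xi> \<in> s_space \<Longrightarrow> \<xi> \<in> s'_space"
  using s_summable_imp_d_summable(1)[of 1 \<xi> 1] by (auto simp: s_space_iff s'_space_iff)

lemma snorm_nonneg: "s_summable n \<xi> \<Longrightarrow> 0 \<le> snorm n \<xi>"
  by (auto simp: snorm_def s_summable_def intro!: suminf_nonneg)

lemma dnorm_nonneg: "d_summable n \<xi> \<Longrightarrow> 0 \<le> dnorm n \<xi>"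
  by (auto simp: dnorm_def d_summable_def intro!: suminf_nonneg)

lemma L2_set_le_snorm:
  assumes "s_summable n \<xi>"
  shows "L2_set (\<lambda>i. cmod (\<xi> i) * wt i ^ n) {..<p} \<le> snorm n \<xi>"
  unfolding L2_set_def snorm_def
  using assms unfolding s_summable_def
  by (intro real_sqrt_le_mono order_trans[OF _ sum_le_suminf[where I="{..<p}"]])
     (auto simp: power_mult_distrib power_mult[symmetric] mult.commute)

lemma L2_set_le_dnorm:
  assumes "d_summable n \<xi>"
  shows "L2_set (\<lambda>i. cmod (\<xi> i) / wt i ^ n) {..<p} \<le> dnorm n \<xi>"
  unfolding L2_set_def dnorm_def
  using assms unfolding d_summable_def
  by (intro real_sqrt_le_mono order_trans[OF _ sum_le_suminf[where I="{..<p}"]])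
     (auto simp: power_divide power_mult[symmetric] mult.commute)

text \<open>Cauchy-Schwarz and Minkowski are available for the finite \<open>L2_set\<close>; this
  rule carries uniform bounds on finite sections over to the series.\<close>

lemma s_summableI:
  assumes "\<And>p. L2_set (\<lambda>i. cmod (\<xi> i) * wt i ^ n) {..<p} \<le> B"
  shows "s_summable n \<xi>" "snorm n \<xi> \<le> B"
proof -
  have B: "0 \<le> B" using assms[of 0] by simp
  have le: "(\<Sum>i<p. (cmod (\<xi> i))\<^sup>2 * wt i ^ (2*n)) \<le> B\<^sup>2" for p
  proof -
    have "(\<Sum>i<p. (cmod (\<xi> i))\<^sup>2 * wt i ^ (2*n)) = (L2_set (\<lambda>i. cmod (\<xi> i) * wt i ^ n) {..<p})\<^sup>2"
      unfolding L2_set_def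
      by (subst real_sqrt_pow2)
         (auto intro!: sum_nonneg simp: power_mult_distrib power_mult[symmetric] mult.commute)
    also have "\<dots> \<le> B\<^sup>2"
      by (intro power_mono assms) simp
    finally show ?thesis .
  qed
  show 1: "s_summable n \<xi>"
    unfolding s_summable_def by (rule summableI_nonneg_bounded[OF _ le]) simp
  show "snorm n \<xi> \<le> B"
    unfolding snorm_def
    by (rule real_le_lsqrt) (use B 1 le in \<open>auto simp: s_summable_def intro!: suminf_le_const\<close>)
qed

lemma cmod_le_snorm:
  assumes "s_summable n \<xi>"
  shows "cmod (\<xi> i) \<le> snorm n \<xi>"
proof -
  have "cmod (\<xi> i) \<le> cmod (\<xi> i) * wt i ^ n"
    using mult_left_mono[of 1 "wt i ^ n" "cmod (\<xi> i)"] by simp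
  also have "\<dots> \<le> L2_set (\<lambda>i. cmod (\<xi> i) * wt i ^ n) {..<Suc i}"
    by (rule member_le_L2_set) auto
  finally show ?thesis using L2_set_le_snorm[OF assms] by (rule order_trans)
qed

lemma s_summable_scale: "s_summable n \<xi> \<Longrightarrow> s_summable n (\<lambda>i. c * \<xi> i)"
  using summable_mult[of "\<lambda>i. (cmod (\<xi> i))\<^sup>2 * wt i ^ (2*n)" "(cmod c)\<^sup>2"]
  by (simp add: s_summable_def norm_mult power_mult_distrib mult.assoc)

lemma d_summable_scale: "d_summable n \<xi> \<Longrightarrow> d_summable n (\<lambda>i. c * \<xi> i)"
  using summable_mult[of "\<lambda>i. (cmod (\<xi> i))\<^sup>2 / wt i ^ (2*n)" "(cmod c)\<^sup>2"]
  by (simp add: d_summable_def norm_mult power_mult_distrib)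

lemma snorm_scale: "s_summable n \<xi> \<Longrightarrow> snorm n (\<lambda>i. c * \<xi> i) = cmod c * snorm n \<xi>"
  using suminf_mult[of "\<lambda>i. (cmod (\<xi> i))\<^sup>2 * wt i ^ (2*n)" "(cmod c)\<^sup>2"]
  by (simp add: s_summable_def snorm_def norm_mult power_mult_distrib mult.assoc real_sqrt_mult)

lemma dnorm_scale: "d_summable n \<xi> \<Longrightarrow> dnorm n (\<lambda>i. c * \<xi> i) = cmod c * dnorm n \<xi>"
  using suminf_mult[of "\<lambda>i. (cmod (\<xi> i))\<^sup>2 / wt i ^ (2*n)" "(cmod c)\<^sup>2"]
  by (simp add: d_summable_def dnorm_def norm_mult power_mult_distrib real_sqrt_mult)

lemma s_summable_add:
  assumes "s_summable n \<xi>" "s_summable n \<eta>"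
  shows "s_summable n (\<lambda>i. \<xi> i + \<eta> i)" "snorm n (\<lambda>i. \<xi> i + \<eta> i) \<le> snorm n \<xi> + snorm n \<eta>"
proof -
  have "L2_set (\<lambda>i. cmod (\<xi> i + \<eta> i) * wt i ^ n) {..<p} \<le> snorm n \<xi> + snorm n \<eta>" for p
  proof -
    have "L2_set (\<lambda>i. cmod (\<xi> i + \<eta> i) * wt i ^ n) {..<p}
        \<le> L2_set (\<lambda>i. cmod (\<xi> i) * wt i ^ n + cmod (\<eta> i) * wt i ^ n) {..<p}"
      by (rule L2_set_mono)
         (auto simp: norm_triangle_ineq simp flip: distrib_right intro!: mult_right_mono)
    also have "\<dots> \<le> L2_set (\<lambda>i. cmod (\<xi> i) * wt i ^ n) {..<p} + L2_set (\<lambda>i. cmod (\<eta> i) * wt i ^ n) {..<p}"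
      by (rule L2_set_triangle_ineq)
    also have "\<dots> \<le> snorm n \<xi> + snorm n \<eta>"
      by (intro add_mono L2_set_le_snorm assms)
    finally show ?thesis .
  qed
  from s_summableI[OF this] show "s_summable n (\<lambda>i. \<xi> i + \<eta> i)"
    "snorm n (\<lambda>i. \<xi> i + \<eta> i) \<le> snorm n \<xi> + snorm n \<eta>" by blast+
qed

text \<open>Cauchy-Schwarz after inserting the weight w^n into one factor and its inverse into the
  other.\<close>

lemma pair_summable:
  assumes "d_summable n \<xi>" "s_summable n \<eta>"
  shows "summable (\<lambda>i. \<xi> i * cnj (\<eta> i))" "cmod (pair \<xi> \<eta>) \<le> dnorm n \<xi> * snorm n \<eta>"
proof -
  have le: "(\<Sum>i<p. cmod (\<xi> i * cnj (\<eta> i))) \<le> dnorm n \<xi> * snorm n \<eta>" for p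
  proof -
    have "(\<Sum>i<p. cmod (\<xi> i * cnj (\<eta> i)))
        = (\<Sum>i<p. \<bar>cmod (\<xi> i) / wt i ^ n\<bar> * \<bar>cmod (\<eta> i) * wt i ^ n\<bar>)"
      by (intro sum.cong) (auto simp: norm_mult)
    also have "\<dots> \<le> L2_set (\<lambda>i. cmod (\<xi> i) / wt i ^ n) {..<p} * L2_set (\<lambda>i. cmod (\<eta> i) * wt i ^ n) {..<p}"
      by (rule L2_set_mult_ineq)
    also have "\<dots> \<le> dnorm n \<xi> * snorm n \<eta>"
      by (intro mult_mono L2_set_le_dnorm L2_set_le_snorm assms dnorm_nonneg) auto
    finally show ?thesis .
  qed
  have 1: "summable (\<lambda>i. cmod (\<xi> i * cnj (\<eta> i)))"
    by (rule summableI_nonneg_bounded[OF _ le]) simp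
  then show "summable (\<lambda>i. \<xi> i * cnj (\<eta> i))" by (rule summable_norm_cancel)
  show "cmod (pair \<xi> \<eta>) \<le> dnorm n \<xi> * snorm n \<eta>"
    unfolding pair_def by (rule order_trans[OF summable_norm[OF 1] suminf_le_const[OF 1 le]])
qed

section \<open>Unit sequences, truncations and tails\<close>

definition unit_seq :: "nat \<Rightarrow> seqc" where "unit_seq k = (\<lambda>i. if i = k then 1 else 0)"
definition trunc :: "nat \<Rightarrow> seqc \<Rightarrow> seqc" where "trunc p \<xi> = (\<lambda>i. if i < p then \<xi> i else 0)"
definition tail :: "nat \<Rightarrow> seqc \<Rightarrow> seqc" where "tail p \<xi> = (\<lambda>i. if i < p then 0 else \<xi> i)"

lemma unit_seq_d: "d_summable n (unit_seq k)" "dnorm n (unit_seq k) = 1 / wt k ^ n"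
proof -
  have "(\<lambda>i. (cmod (unit_seq k i))\<^sup>2 / wt i ^ (2*n)) = (\<lambda>i. if i = k then 1 / wt k ^ (2*n) else 0)"
    by (auto simp: unit_seq_def)
  then have "(\<lambda>i. (cmod (unit_seq k i))\<^sup>2 / wt i ^ (2*n)) sums (1 / wt k ^ (2*n))"
    using sums_If_finite_set[of "{k}" "\<lambda>_. 1 / wt k ^ (2*n)"] by simp
  then show "d_summable n (unit_seq k)" "dnorm n (unit_seq k) = 1 / wt k ^ n"
    by (auto simp: d_summable_def dnorm_def sums_iff real_sqrt_divide power_mult mult.commute[of 2])
qed

lemma unit_seq_s: "s_summable n (unit_seq k)" "snorm n (unit_seq k) = wt k ^ n"
proof -
  have "(\<lambda>i. (cmod (unit_seq k i))\<^sup>2 * wt i ^ (2*n)) = (\<lambda>i. if i = k then wt k ^ (2*n) else 0)"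
    by (auto simp: unit_seq_def)
  then have "(\<lambda>i. (cmod (unit_seq k i))\<^sup>2 * wt i ^ (2*n)) sums (wt k ^ (2*n))"
    using sums_If_finite_set[of "{k}" "\<lambda>_. wt k ^ (2*n)"] by simp
  then show "s_summable n (unit_seq k)" "snorm n (unit_seq k) = wt k ^ n"
    by (auto simp: s_summable_def snorm_def sums_iff power_mult mult.commute[of 2])
qed

lemma unit_seq_s_space: "unit_seq k \<in> s_space" and unit_seq_s'_space: "unit_seq k \<in> s'_space"
  using unit_seq_s(1) s_subset_s' by (auto simp: s_space_iff)

lemma trunc_d_summable: "d_summable n (trunc p \<xi>)"
  unfolding d_summable_def by (rule summable_finite[of "{..<p}"]) (auto simp: trunc_def)

lemma trunc_s'_space: "trunc p \<xi> \<in> s'_space"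
  using trunc_d_summable by (auto simp: s'_space_iff)

lemma tail_d_summable: "d_summable n \<xi> \<Longrightarrow> d_summable n (tail p \<xi>)"
  unfolding d_summable_def
  by (rule summable_comparison_test'[of "\<lambda>i. (cmod (\<xi> i))\<^sup>2 / wt i ^ (2*n)" 0]) (auto simp: tail_def)

lemma trunc_plus_tail: "\<xi> = (\<lambda>i. trunc p \<xi> i + tail p \<xi> i)"
  by (auto simp: trunc_def tail_def)

text \<open>The squared norm of the tail is the full series minus its p-th partial sum. All passages
  from finitely supported sequences to s' rest on this limit.\<close>

lemma dnorm_tail_tendsto:
  assumes "d_summable n \<xi>"
  shows "(\<lambda>p. dnorm n (tail p \<xi>)) \<longlonglongrightarrow> 0"
proof -
  define f where "f = (\<lambda>i. (cmod (\<xi> i))\<^sup>2 / wt i ^ (2*n))"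
  have f: "summable f" using assms by (simp add: f_def d_summable_def)
  have "dnorm n (tail p \<xi>) = sqrt (suminf f - sum f {..<p})" for p
  proof -
    have "(\<lambda>i. f i - (if i \<in> {..<p} then f i else 0)) sums (suminf f - sum f {..<p})"
      by (intro sums_diff summable_sums f sums_If_finite_set) auto
    also have "(\<lambda>i. f i - (if i \<in> {..<p} then f i else 0)) = (\<lambda>i. (cmod (tail p \<xi> i))\<^sup>2 / wt i ^ (2*n))"
      by (auto simp: f_def tail_def)
    finally show ?thesis by (simp add: dnorm_def sums_iff)
  qed
  moreover have "(\<lambda>p. sqrt (suminf f - sum f {..<p})) \<longlonglongrightarrow> sqrt (suminf f - suminf f)"
    by (intro tendsto_intros summable_LIMSEQ f)
  ultimately show ?thesis by simp
qed

lemma trunc_Suc: "trunc (Suc p) \<xi> = (\<lambda>i. trunc p \<xi> i + \<xi> p * unit_seq p i)"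
  by (auto simp: trunc_def unit_seq_def less_Suc_eq)

lemma pair_unit_right: "pair \<xi> (unit_seq k) = \<xi> k"
proof -
  have "(\<lambda>i. \<xi> i * cnj (unit_seq k i)) = (\<lambda>i. if i = k then \<xi> k else 0)"
    by (auto simp: unit_seq_def)
  then show ?thesis using sums_single[of k "\<lambda>_. \<xi> k"] by (simp add: pair_def sums_iff)
qed

lemma pair_commute: "summable (\<lambda>i. \<xi> i * cnj (\<eta> i)) \<Longrightarrow> pair \<eta> \<xi> = cnj (pair \<xi> \<eta>)"
  unfolding pair_def
  by (drule summable_sums, drule sums_cnj[THEN iffD2]) (simp add: sums_iff mult.commute)

lemma s'_space_add:
  assumes "\<xi> \<in> s'_space" "\<eta> \<in> s'_space"
  shows "(\<lambda>i. \<xi> i + \<eta> i) \<in> s'_space"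
proof -
  obtain n m where nm: "1 \<le> n" "d_summable n \<xi>" "1 \<le> m" "d_summable m \<eta>"
    using assms by (auto simp: s'_space_iff)
  \<comment> \<open>s' is an increasing union of weighted l2 spaces, so both sequences lie in the
    one with the larger index.\<close>
  define N where "N = max n m"
  have "d_summable N \<xi>" "d_summable N \<eta>"
    using nm d_summable_mono by (auto simp: N_def)
  then have "summable (\<lambda>i. 2 * ((cmod (\<xi> i))\<^sup>2 / wt i ^ (2*N)) + 2 * ((cmod (\<eta> i))\<^sup>2 / wt i ^ (2*N)))"
    unfolding d_summable_def by (intro summable_add summable_mult)
  then have "d_summable N (\<lambda>i. \<xi> i + \<eta> i)"
    unfolding d_summable_def
  proof (rule summable_comparison_test'[of _ 0])
    fix i
    have "(cmod (\<xi> i + \<eta> i))\<^sup>2 \<le> (cmod (\<xi> i) + cmod (\<eta> i))\<^sup>2"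
      by (intro power_mono norm_triangle_ineq) simp
    \<comment> \<open>The difference of the two sides is the square of the difference of the
      moduli.\<close>
    also have "\<dots> \<le> 2 * (cmod (\<xi> i))\<^sup>2 + 2 * (cmod (\<eta> i))\<^sup>2"
      using sum_squares_ge_zero[of "cmod (\<xi> i) - cmod (\<eta> i)" 0] by (simp add: power2_eq_square algebra_simps)
    finally show "norm ((cmod (\<xi> i + \<eta> i))\<^sup>2 / wt i ^ (2*N))
        \<le> 2 * ((cmod (\<xi> i))\<^sup>2 / wt i ^ (2*N)) + 2 * ((cmod (\<eta> i))\<^sup>2 / wt i ^ (2*N))"
      by (simp add: divide_right_mono flip: add_divide_distrib)
  qed
  then show ?thesis using nm d_summable_s'[of N] by (simp add: N_def)
qed

lemma s'_space_scale: "\<xi> \<in> s'_space \<Longrightarrow> (\<lambda>i. c * \<xi> i) \<in> s'_space"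
  using d_summable_scale by (auto simp: s'_space_iff)

section \<open>Operators on the dual sequence space\<close>

lemma S_spaceD:
  assumes "x \<in> S_space"
  shows S_space_in_s: "\<xi> \<in> s'_space \<Longrightarrow> x \<xi> \<in> s_space"
    and S_space_outside: "\<xi> \<notin> s'_space \<Longrightarrow> x \<xi> = (\<lambda>i. 0)"
    and S_space_add: "\<xi> \<in> s'_space \<Longrightarrow> \<eta> \<in> s'_space \<Longrightarrow> x (\<lambda>i. \<xi> i + \<eta> i) = (\<lambda>i. x \<xi> i + x \<eta> i)"
    and S_space_scale: "\<xi> \<in> s'_space \<Longrightarrow> x (\<lambda>i. c * \<xi> i) = (\<lambda>i. c * x \<xi> i)"
    and S_space_bdd: "1 \<le> n \<Longrightarrow> bdd_above ((\<lambda>\<xi>. snorm n (x \<xi>)) ` dball n)"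
  using assms by (auto simp: S_space_def)

lemma S_space_summable: "x \<in> S_space \<Longrightarrow> \<xi> \<in> s'_space \<Longrightarrow> 1 \<le> n \<Longrightarrow> s_summable n (x \<xi>)"
  using S_space_in_s by (auto simp: s_space_iff)

lemma dball_s': "1 \<le> n \<Longrightarrow> \<xi> \<in> dball n \<Longrightarrow> \<xi> \<in> s'_space"
  by (auto simp: s'_space_iff dball_iff)

lemma zero_in_dball: "(\<lambda>i. 0) \<in> dball n"
  by (simp add: dball_def dnorm_def)

lemma opn_leI:
  assumes "\<And>\<xi>. \<xi> \<in> dball n \<Longrightarrow> snorm n (x \<xi>) \<le> B"
  shows "opn n x \<le> B"
  unfolding opn_def using assms zero_in_dball by (intro cSup_least) auto

lemma opn_upper:
  assumes "x \<in> S_space" "1 \<le> n" "\<xi> \<in> dball n"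
  shows "snorm n (x \<xi>) \<le> opn n x"
  unfolding opn_def using assms S_space_bdd by (intro cSup_upper) auto

lemma opn_nonneg:
  assumes "x \<in> S_space" "1 \<le> n"
  shows "0 \<le> opn n x"
  using order_trans[OF snorm_nonneg opn_upper[OF assms zero_in_dball]]
    S_space_summable[OF assms(1) dball_s'[OF assms(2) zero_in_dball] assms(2)] by blast

text \<open>Raising the index shrinks \<open>dnorm\<close>, which enlarges the ball, and also
  increases \<open>snorm\<close>; both effects push the supremum up.\<close>

lemma opn_mono:
  assumes x: "x \<in> S_space" and mn: "1 \<le> m" "m \<le> n"
  shows "opn m x \<le> opn n x"
proof (rule opn_leI)
  fix \<xi> assume \<xi>: "\<xi> \<in> dball m"
  then have d: "d_summable m \<xi>" "dnorm m \<xi> \<le> 1" by (auto simp: dball_iff)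
  have d': "d_summable n \<xi>" by (rule d_summable_mono[OF d(1) mn(2)])
  have "dnorm n \<xi> \<le> dnorm m \<xi>"
    unfolding dnorm_def using d(1) d' mn
    by (intro real_sqrt_le_mono suminf_le) (auto simp: d_summable_def intro!: divide_left_mono power_increasing)
  then have "\<xi> \<in> dball n" using d d' by (simp add: dball_iff)
  moreover have s: "s_summable n (x \<xi>)" "s_summable m (x \<xi>)"
    using S_space_summable[OF x dball_s'[OF mn(1) \<xi>]] mn by auto
  then have "snorm m (x \<xi>) \<le> snorm n (x \<xi>)"
    unfolding snorm_def using mn
    by (intro real_sqrt_le_mono suminf_le) (auto simp: s_summable_def intro!: mult_left_mono power_increasing)
  ultimately show "snorm m (x \<xi>) \<le> opn n x" using opn_upper[OF x, of n \<xi>] mn by simp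
qed

text \<open>Handles the degenerate case of homogeneity arguments, where normalizing would divide by
  zero.\<close>

lemma le_zero_if_scaled_le:
  fixes a b :: real
  assumes "\<And>t. 0 \<le> t \<Longrightarrow> t * a \<le> b"
  shows "a \<le> 0"
proof (rule ccontr)
  assume "\<not> a \<le> 0"
  then have "0 < a" by simp
  \<comment> \<open>This multiple of a equals |b| + 1, which exceeds b.\<close>
  have "(\<bar>b\<bar> + 1) / a * a \<le> b" using \<open>0 < a\<close> by (intro assms) simp
  then show False using \<open>0 < a\<close> by simp
qed

text \<open>By homogeneity: scale \<xi> by the inverse of its norm, or by arbitrarily large factors
  when its norm is 0.\<close>

lemma snorm_le_opn:
  assumes x: "x \<in> S_space" and n: "1 \<le> n" and d: "d_summable n \<xi>"
  shows "snorm n (x \<xi>) \<le> opn n x * dnorm n \<xi>"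
proof -
  have \<xi>: "\<xi> \<in> s'_space" using n d by (auto simp: s'_space_iff)
  have scaled: "t * snorm n (x \<xi>) \<le> opn n x" if "0 \<le> t" "t * dnorm n \<xi> \<le> 1" for t
  proof -
    have "(\<lambda>i. of_real t * \<xi> i) \<in> dball n"
      using that d_summable_scale[OF d] dnorm_scale[OF d] by (simp add: dball_iff)
    from opn_upper[OF x n this] show ?thesis
      using that snorm_scale[OF S_space_summable[OF x \<xi> n], of "of_real t"]
      by (simp add: S_space_scale[OF x \<xi>])
  qed
  show ?thesis
  proof (cases "dnorm n \<xi> = 0")
    case True
    then show ?thesis using le_zero_if_scaled_le[of "snorm n (x \<xi>)" "opn n x"] scaled by simp
  next
    case False
    then have "0 < dnorm n \<xi>" using dnorm_nonneg[OF d] by simp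
    then show ?thesis using scaled[of "1 / dnorm n \<xi>"] by (simp add: field_simps)
  qed
qed

lemma S_spaceI:
  assumes "\<And>\<xi> \<eta>. \<xi> \<in> s'_space \<Longrightarrow> \<eta> \<in> s'_space \<Longrightarrow> x (\<lambda>i. \<xi> i + \<eta> i) = (\<lambda>i. x \<xi> i + x \<eta> i)"
    and "\<And>\<xi> c. \<xi> \<in> s'_space \<Longrightarrow> x (\<lambda>i. c * \<xi> i) = (\<lambda>i. c * x \<xi> i)"
    and "\<And>\<xi>. \<xi> \<notin> s'_space \<Longrightarrow> x \<xi> = (\<lambda>i. 0)"
    and bound: "\<And>n. 1 \<le> n \<Longrightarrow> \<exists>B\<ge>0. \<forall>\<xi>. d_summable n \<xi> \<longrightarrow> s_summable n (x \<xi>) \<and> snorm n (x \<xi>) \<le> B * dnorm n \<xi>"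
  shows "x \<in> S_space"
proof -
  have "x \<xi> \<in> s_space" if \<xi>: "\<xi> \<in> s'_space" for \<xi>
  proof -
    obtain m where m: "1 \<le> m" "d_summable m \<xi>" using \<xi> by (auto simp: s'_space_iff)
    have "s_summable n (x \<xi>)" if n: "1 \<le> n" for n
    proof -
      \<comment> \<open>The bound at index n says nothing about \<xi>, which is only known to be
        summable at index m. It is used at the larger index, and summability of the image is then
        lowered to n.\<close>
      have "d_summable (max m n) \<xi>" using m(2) by (rule d_summable_mono) simp
      then have "s_summable (max m n) (x \<xi>)" using bound[of "max m n"] m(1) le_max_iff_disj[of 1 m n] by auto
      then show ?thesis by (rule s_summable_mono) simp
    qed
    then show ?thesis by (simp add: s_space_iff)
  qed
  moreover have "bdd_above ((\<lambda>\<xi>. snorm n (x \<xi>)) ` dball n)" if n: "1 \<le> n" for n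
  proof -
    obtain B where B: "0 \<le> B" "\<And>\<xi>. d_summable n \<xi> \<Longrightarrow> snorm n (x \<xi>) \<le> B * dnorm n \<xi>"
      using bound[OF n] by blast
    show ?thesis
    proof (rule bdd_aboveI2)
      fix \<xi> assume "\<xi> \<in> dball n"
      then have "d_summable n \<xi>" "dnorm n \<xi> \<le> 1" by (auto simp: dball_iff)
      then show "snorm n (x \<xi>) \<le> B" using B(2)[of \<xi>] mult_left_mono[of "dnorm n \<xi>" 1 B] B(1) by simp
    qed
  qed
  ultimately show ?thesis using assms(1-3) by (simp add: S_space_def)
qed

section \<open>Algebraic operations and homogeneity on S\<close>

lemma addS_S_space:
  assumes x: "x \<in> S_space" and y: "y \<in> S_space"
  shows "addS x y \<in> S_space"
proof (rule S_spaceI)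
  fix n :: nat assume n: "1 \<le> n"
  show "\<exists>B\<ge>0. \<forall>\<xi>. d_summable n \<xi> \<longrightarrow> s_summable n (addS x y \<xi>) \<and> snorm n (addS x y \<xi>) \<le> B * dnorm n \<xi>"
  proof (intro exI conjI allI impI)
    show "0 \<le> opn n x + opn n y" using opn_nonneg n x y by simp
    fix \<xi> assume d: "d_summable n \<xi>"
    note s = S_space_summable[OF x d_summable_s'[OF n d] n] S_space_summable[OF y d_summable_s'[OF n d] n]
    from s_summable_add[OF s]
    show "s_summable n (addS x y \<xi>)" "snorm n (addS x y \<xi>) \<le> (opn n x + opn n y) * dnorm n \<xi>"
      using snorm_le_opn[OF x n d] snorm_le_opn[OF y n d] by (auto simp: addS_def algebra_simps)
  qed
qed (auto simp: addS_def S_space_add[OF x] S_space_add[OF y] S_space_scale[OF x] S_space_scale[OF y] S_space_outside[OF x] S_space_outside[OF y] algebra_simps)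

lemma smulS_S_space:
  assumes x: "x \<in> S_space"
  shows "smulS c x \<in> S_space"
proof (rule S_spaceI)
  fix n :: nat assume n: "1 \<le> n"
  show "\<exists>B\<ge>0. \<forall>\<xi>. d_summable n \<xi> \<longrightarrow> s_summable n (smulS c x \<xi>) \<and> snorm n (smulS c x \<xi>) \<le> B * dnorm n \<xi>"
  proof (intro exI conjI allI impI)
    show "0 \<le> cmod c * opn n x" using opn_nonneg n x by simp
    fix \<xi> assume d: "d_summable n \<xi>"
    note s = S_space_summable[OF x d_summable_s'[OF n d] n]
    from s_summable_scale[OF s] snorm_scale[OF s]
    show "s_summable n (smulS c x \<xi>)" "snorm n (smulS c x \<xi>) \<le> cmod c * opn n x * dnorm n \<xi>"
      using mult_left_mono[OF snorm_le_opn[OF x n d], of "cmod c"] by (auto simp: smulS_def algebra_simps)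
  qed
qed (auto simp: smulS_def S_space_add[OF x] S_space_scale[OF x] S_space_outside[OF x] algebra_simps)

lemma mulS_S_space:
  assumes x: "x \<in> S_space" and y: "y \<in> S_space"
  shows "mulS x y \<in> S_space"
proof (rule S_spaceI)
  fix n :: nat assume n: "1 \<le> n"
  show "\<exists>B\<ge>0. \<forall>\<xi>. d_summable n \<xi> \<longrightarrow> s_summable n (mulS x y \<xi>) \<and> snorm n (mulS x y \<xi>) \<le> B * dnorm n \<xi>"
  proof (intro exI conjI allI impI)
    show "0 \<le> opn n x * opn n y" using opn_nonneg n x y by simp
    fix \<xi> assume d: "d_summable n \<xi>"
    have s: "s_summable n (y \<xi>)" using S_space_summable[OF y d_summable_s'[OF n d] n] .
    then show "s_summable n (mulS x y \<xi>)"
      using S_space_summable[OF x d_summable_s'[OF n s_summable_imp_d_summable(1)] n] by (simp add: mulS_def)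
    have "snorm n (x (y \<xi>)) \<le> opn n x * dnorm n (y \<xi>)"
      by (intro snorm_le_opn x n s_summable_imp_d_summable(1)[OF s])
    also have "\<dots> \<le> opn n x * (opn n y * dnorm n \<xi>)"
      using s_summable_imp_d_summable(2)[OF s, of n] snorm_le_opn[OF y n d]
      by (intro mult_left_mono opn_nonneg x n) simp
    finally show "snorm n (mulS x y \<xi>) \<le> opn n x * opn n y * dnorm n \<xi>" by (simp add: mulS_def algebra_simps)
  qed
next
  fix \<xi> assume "\<xi> \<notin> s'_space"
  \<comment> \<open>Outside s' the default value of y is the zero sequence, which does lie in s';
    that x maps it to 0 follows by writing it as 0 times a unit sequence.\<close>
  then show "mulS x y \<xi> = (\<lambda>i. 0)"
    using S_space_scale[OF x unit_seq_s'_space, of 0] by (simp add: mulS_def S_space_outside[OF y])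
qed (auto simp: mulS_def S_space_add[OF x] S_space_add[OF y] S_space_scale[OF x] S_space_scale[OF y]
       s_subset_s'[OF S_space_in_s[OF y]])

lemma zero_S_space: "(\<lambda>\<xi> i. 0) \<in> S_space"
  by (rule S_spaceI) (auto simp: s_summable_def snorm_def intro!: exI[of _ 0])

lemma sumS_Suc: "sumS f (Suc m) = addS (sumS f m) (f m)"
  by (simp add: sumS_def addS_def)

lemma sumS_S_space: "(\<And>j. j < m \<Longrightarrow> f j \<in> S_space) \<Longrightarrow> sumS f m \<in> S_space"
proof (induction m)
  case 0
  then show ?case using zero_S_space by (simp add: sumS_def)
next
  case (Suc m)
  then show ?case by (simp add: sumS_Suc addS_S_space)
qed

lemma opn_smulS_le:
  assumes x: "x \<in> S_space" and n: "1 \<le> n"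
  shows "opn n (smulS c x) \<le> cmod c * opn n x"
proof (rule opn_leI)
  fix \<xi> assume \<xi>: "\<xi> \<in> dball n"
  show "snorm n (smulS c x \<xi>) \<le> cmod c * opn n x"
    using snorm_scale[OF S_space_summable[OF x dball_s'[OF n \<xi>] n], of c]
      mult_left_mono[OF opn_upper[OF x n \<xi>], of "cmod c"] by (simp add: smulS_def)
qed

text \<open>The normalization of \<open>snorm_le_opn\<close> one level up, for positively
  homogeneous functions of an operator. Here f will be the modulus of a bilinear form with one
  argument frozen.\<close>

lemma le_opn_if_le_on_unit_ball:
  assumes hom: "\<And>t. 0 \<le> t \<Longrightarrow> f (smulS (complex_of_real t) x) = t * f x"
    and le: "\<And>z. z \<in> S_space \<Longrightarrow> opn n z \<le> 1 \<Longrightarrow> f z \<le> (b::real)"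
    and x: "x \<in> S_space" and n: "1 \<le> n"
  shows "f x \<le> b * opn n x"
proof -
  have scaled: "t * f x \<le> b" if "0 \<le> t" "t * opn n x \<le> 1" for t
    using le[of "smulS (of_real t) x"] smulS_S_space[OF x] opn_smulS_le[OF x n, of "of_real t"] that hom
    by simp
  show ?thesis
  proof (cases "opn n x = 0")
    case True
    then show ?thesis using le_zero_if_scaled_le[of "f x" b] scaled by simp
  next
    case False
    then have "0 < opn n x" using opn_nonneg[OF x n] by simp
    then show ?thesis using scaled[of "1 / opn n x"] by (simp add: field_simps)
  qed
qed

section \<open>Matrix coefficients and the adjoint\<close>

lemma S_space_trunc_tail:
  assumes "x \<in> S_space" "1 \<le> n" "d_summable n \<xi>"
  shows "x \<xi> = (\<lambda>i. x (trunc p \<xi>) i + x (tail p \<xi>) i)"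
  using S_space_add[OF assms(1) trunc_s'_space, of "tail p \<xi>" p \<xi>]
    d_summable_s'[OF assms(2) tail_d_summable[OF assms(3)]] trunc_plus_tail[of \<xi> p]
  by simp

lemma S_space_trunc:
  assumes x: "x \<in> S_space"
  shows "x (trunc p \<xi>) i = (\<Sum>k<p. \<xi> k * x (unit_seq k) i)"
proof (induction p)
  case 0
  have "trunc 0 \<xi> = (\<lambda>i. 0 * unit_seq 0 i)" by (simp add: trunc_def)
  then show ?case using S_space_scale[OF x unit_seq_s'_space, of 0] by simp
next
  case (Suc p)
  have "(\<lambda>i. \<xi> p * unit_seq p i) \<in> s'_space"
    using d_summable_s'[OF _ d_summable_scale[OF unit_seq_d(1)], of 1] by simp
  then show ?case
    using Suc by (simp add: trunc_Suc S_space_add[OF x trunc_s'_space] S_space_scale[OF x unit_seq_s'_space])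
qed

lemma tendsto_zero_bound:
  fixes f :: "nat \<Rightarrow> complex"
  assumes "g \<longlonglongrightarrow> (0::real)" "\<And>p. cmod (f p) \<le> c * g p"
  shows "f \<longlonglongrightarrow> 0"
proof -
  have "(\<lambda>p. c * g p) \<longlonglongrightarrow> 0" using tendsto_mult_left[OF assms(1), of c] by simp
  then show ?thesis by (rule tendsto_0_le[where K=1])
      (use order_trans[OF assms(2) abs_ge_self] in \<open>auto intro!: always_eventually\<close>)
qed

text \<open>The matrix entry in row i and column k is \<open>x (unit_seq k) i\<close>. A partial sum
  is the value of x on a truncation of \<xi>, and the remainder is its value on the tail, which
  tends to 0 because x is bounded.\<close>

lemma matrix_sums:
  assumes x: "x \<in> S_space" and \<xi>: "\<xi> \<in> s'_space"
  shows "(\<lambda>k. \<xi> k * x (unit_seq k) i) sums x \<xi> i"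
proof -
  obtain n where n: "1 \<le> n" "d_summable n \<xi>" using \<xi> by (auto simp: s'_space_iff)
  have "(\<lambda>p. x (tail p \<xi>) i) \<longlonglongrightarrow> 0"
  proof (rule tendsto_zero_bound[OF dnorm_tail_tendsto[OF n(2)]])
    fix p
    note d = tail_d_summable[OF n(2), of p]
    show "cmod (x (tail p \<xi>) i) \<le> opn n x * dnorm n (tail p \<xi>)"
      using cmod_le_snorm[OF S_space_summable[OF x d_summable_s'[OF n(1) d] n(1)], of i]
        snorm_le_opn[OF x n(1) d] by simp
  qed
  from tendsto_diff[OF tendsto_const[of "x \<xi> i"] this]
  have "(\<lambda>p. x \<xi> i - x (tail p \<xi>) i) \<longlonglongrightarrow> x \<xi> i" by simp
  moreover have "x \<xi> i - x (tail p \<xi>) i = (\<Sum>k<p. \<xi> k * x (unit_seq k) i)" for p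
    using fun_cong[OF S_space_trunc_tail[OF x n, of p], of i] S_space_trunc[OF x] by simp
  ultimately show ?thesis by (simp add: sums_def)
qed

section \<open>Sesquilinearity of the duality pairing\<close>

lemma pair_summable':
  assumes "\<xi> \<in> s'_space" "\<eta> \<in> s_space"
  shows "summable (\<lambda>i. \<xi> i * cnj (\<eta> i))"
  using assms pair_summable(1) by (fastforce simp: s'_space_iff s_space_iff)

lemma pair_sums: "\<xi> \<in> s'_space \<Longrightarrow> \<eta> \<in> s_space \<Longrightarrow> (\<lambda>i. \<xi> i * cnj (\<eta> i)) sums pair \<xi> \<eta>"
  unfolding pair_def by (rule summable_sums[OF pair_summable'])

lemma pair_add_left:
  assumes "\<xi> \<in> s'_space" "\<xi>' \<in> s'_space" "\<eta> \<in> s_space"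
  shows "pair (\<lambda>i. \<xi> i + \<xi>' i) \<eta> = pair \<xi> \<eta> + pair \<xi>' \<eta>"
  using sums_add[OF pair_sums[OF assms(1,3)] pair_sums[OF assms(2,3)]]
  unfolding pair_def by (simp add: sums_iff algebra_simps)

lemma pair_scale_left:
  assumes "\<xi> \<in> s'_space" "\<eta> \<in> s_space"
  shows "pair (\<lambda>i. c * \<xi> i) \<eta> = c * pair \<xi> \<eta>"
  using sums_mult[OF pair_sums[OF assms], of c]
  unfolding pair_def by (simp add: sums_iff algebra_simps)

lemma pair_add_right:
  assumes "\<xi> \<in> s'_space" "\<eta> \<in> s_space" "\<eta>' \<in> s_space"
  shows "pair \<xi> (\<lambda>i. \<eta> i + \<eta>' i) = pair \<xi> \<eta> + pair \<xi> \<eta>'"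
  using sums_add[OF pair_sums[OF assms(1,2)] pair_sums[OF assms(1,3)]]
  unfolding pair_def by (simp add: sums_iff algebra_simps)

lemma pair_scale_right:
  assumes "\<xi> \<in> s'_space" "\<eta> \<in> s_space"
  shows "pair \<xi> (\<lambda>i. c * \<eta> i) = cnj c * pair \<xi> \<eta>"
  using sums_mult[OF pair_sums[OF assms], of "cnj c"]
  unfolding pair_def by (simp add: sums_iff algebra_simps)

text \<open>The only possible adjoint: pairing the adjoint relation with \<open>unit_seq i\<close>
  yields its i-th coordinate. This explicit candidate supplies the existence that the definite
  description in \<open>adjS\<close> presupposes.\<close>

definition adj_matrix :: "opS \<Rightarrow> opS" where
  "adj_matrix x \<xi> = (if \<xi> \<in> s'_space then (\<lambda>i. pair \<xi> (x (unit_seq i))) else (\<lambda>i. 0))"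

lemma pair_trunc_eq:
  assumes x: "x \<in> S_space" and \<xi>: "\<xi> \<in> s'_space"
  shows "(\<Sum>i<p. adj_matrix x \<xi> i * cnj (\<eta> i)) = pair \<xi> (x (trunc p \<eta>))"
proof -
  have "(\<lambda>i. \<Sum>k<p. cnj (\<eta> k) * (\<xi> i * cnj (x (unit_seq k) i))) sums (\<Sum>k<p. cnj (\<eta> k) * pair \<xi> (x (unit_seq k)))"
    by (intro sums_sum sums_mult pair_sums \<xi> S_space_in_s x unit_seq_s'_space)
  moreover have "(\<Sum>k<p. cnj (\<eta> k) * (\<xi> i * cnj (x (unit_seq k) i))) = \<xi> i * cnj (x (trunc p \<eta>) i)" for i
    by (simp add: S_space_trunc[OF x] sum_distrib_left algebra_simps)
  ultimately show ?thesis
    using \<xi> by (simp add: pair_def[of \<xi> "x (trunc p \<eta>)"] sums_iff adj_matrix_def mult.commute)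
qed

text \<open>Testing the duality relation against the truncation of the sequence
  \<open>i \<mapsto> (x\<^sup>* \<xi>)\<^sub>i i\<^bsup>2n\<^esup>\<close> bounds the partial sums of \<open>|x\<^sup>* \<xi>|\<^sub>n\<close>.\<close>

lemma adj_matrix_bound:
  assumes x: "x \<in> S_space" and n: "1 \<le> n" and d: "d_summable n \<xi>"
  shows "L2_set (\<lambda>i. cmod (adj_matrix x \<xi> i) * wt i ^ n) {..<p} \<le> opn n x * dnorm n \<xi>"
proof -
  define a where "a = adj_matrix x \<xi>"
  define L where "L = L2_set (\<lambda>i. cmod (a i) * wt i ^ n) {..<p}"
  define \<eta> where "\<eta> = (\<lambda>i. a i * of_real (wt i ^ (2*n)))"
  have \<xi>: "\<xi> \<in> s'_space" using d_summable_s'[OF n d] .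
  have L2: "L\<^sup>2 = (\<Sum>i<p. (cmod (a i))\<^sup>2 * wt i ^ (2*n))"
    unfolding L_def L2_set_def
    by (subst real_sqrt_pow2)
       (auto intro!: sum_nonneg simp: power_mult_distrib power_mult[symmetric] mult.commute)
  \<comment> \<open>The square of \<eta> carries the weight w^(4n); dividing by w^(2n) leaves
    exactly the weight of \<open>L\<close>.\<close>
  have dn: "dnorm n (trunc p \<eta>) = L"
  proof -
    have "(\<lambda>i. (cmod (trunc p \<eta> i))\<^sup>2 / wt i ^ (2*n)) = (\<lambda>i. if i \<in> {..<p} then (cmod (a i))\<^sup>2 * wt i ^ (2*n) else 0)"
      by (auto simp: trunc_def \<eta>_def norm_mult norm_power power_mult_distrib power2_eq_square)
    then have "(\<lambda>i. (cmod (trunc p \<eta> i))\<^sup>2 / wt i ^ (2*n)) sums L\<^sup>2"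
      using sums_If_finite_set[of "{..<p}" "\<lambda>i. (cmod (a i))\<^sup>2 * wt i ^ (2*n)"] L2 by simp
    then show ?thesis by (simp add: dnorm_def sums_iff L_def)
  qed
  have "(\<Sum>i<p. a i * cnj (\<eta> i)) = of_real (L\<^sup>2)"
    unfolding L2 of_real_sum
    by (intro sum.cong) (auto simp: \<eta>_def complex_norm_square[unfolded of_real_power] simp flip: mult.assoc)
  then have "L\<^sup>2 = cmod (pair \<xi> (x (trunc p \<eta>)))"
    using pair_trunc_eq[OF x \<xi>, where p=p and \<eta>=\<eta>] by (simp add: a_def norm_power)
  also have "\<dots> \<le> dnorm n \<xi> * snorm n (x (trunc p \<eta>))"
    by (intro pair_summable d S_space_summable x trunc_s'_space n)
  also have "\<dots> \<le> dnorm n \<xi> * (opn n x * L)"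
    using snorm_le_opn[OF x n trunc_d_summable, of p \<eta>] dn
    by (intro mult_left_mono dnorm_nonneg d) simp
  finally have "L * L \<le> opn n x * dnorm n \<xi> * L" by (simp add: power2_eq_square algebra_simps)
  moreover have "0 \<le> L" by (simp add: L_def)
  moreover have "0 \<le> opn n x * dnorm n \<xi>" using opn_nonneg[OF x n] dnorm_nonneg[OF d] by simp
  ultimately have "L \<le> opn n x * dnorm n \<xi>"
    by (metis mult_right_le_imp_le order_le_less)
  then show ?thesis by (simp add: L_def a_def)
qed

lemma adj_matrix_S_space:
  assumes x: "x \<in> S_space"
  shows "adj_matrix x \<in> S_space"
proof (rule S_spaceI)
  fix n :: nat assume n: "1 \<le> n"
  show "\<exists>B\<ge>0. \<forall>\<xi>. d_summable n \<xi> \<longrightarrow> s_summable n (adj_matrix x \<xi>) \<and> snorm n (adj_matrix x \<xi>) \<le> B * dnorm n \<xi>"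
    using opn_nonneg[OF x n] s_summableI[OF adj_matrix_bound[OF x n]] by blast
qed (auto simp: adj_matrix_def s'_space_add s'_space_scale pair_add_left pair_scale_left
       S_space_in_s[OF x] unit_seq_s'_space)

text \<open>For truncations of \<eta> the relation is the finite identity
  \<open>pair_trunc_eq\<close>; the tail contributes a term that vanishes in the limit.\<close>

lemma pair_adj_matrix:
  assumes x: "x \<in> S_space" and \<xi>: "\<xi> \<in> s'_space" and \<eta>: "\<eta> \<in> s'_space"
  shows "pair (adj_matrix x \<xi>) \<eta> = pair \<xi> (x \<eta>)"
proof -
  obtain n m where nm: "1 \<le> n" "d_summable n \<xi>" "1 \<le> m" "d_summable m \<eta>"
    using assms by (auto simp: s'_space_iff)
  define N where "N = max n m"
  have d: "d_summable N \<xi>" "d_summable N \<eta>" and N: "1 \<le> N"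
    using nm d_summable_mono by (auto simp: N_def)
  note t = tail_d_summable[OF d(2)]
  note t' = d_summable_s'[OF N t]
  have "(\<lambda>p. pair \<xi> (x (tail p \<eta>))) \<longlonglongrightarrow> 0"
  proof (rule tendsto_zero_bound[OF dnorm_tail_tendsto[OF d(2)]])
    fix p
    have "cmod (pair \<xi> (x (tail p \<eta>))) \<le> dnorm N \<xi> * snorm N (x (tail p \<eta>))"
      by (intro pair_summable d S_space_summable x N t')
    also have "\<dots> \<le> dnorm N \<xi> * (opn N x * dnorm N (tail p \<eta>))"
      by (intro mult_left_mono dnorm_nonneg d snorm_le_opn x N t)
    finally show "cmod (pair \<xi> (x (tail p \<eta>))) \<le> (dnorm N \<xi> * opn N x) * dnorm N (tail p \<eta>)"
      by (simp add: algebra_simps)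
  qed
  from tendsto_diff[OF tendsto_const[of "pair \<xi> (x \<eta>)"] this]
  have "(\<lambda>p. pair \<xi> (x \<eta>) - pair \<xi> (x (tail p \<eta>))) \<longlonglongrightarrow> pair \<xi> (x \<eta>)" by simp
  moreover have "pair \<xi> (x \<eta>) - pair \<xi> (x (tail p \<eta>)) = (\<Sum>i<p. adj_matrix x \<xi> i * cnj (\<eta> i))" for p
    using arg_cong[OF S_space_trunc_tail[OF x N d(2), of p], of "pair \<xi>"]
      pair_add_right[OF \<xi> S_space_in_s[OF x trunc_s'_space] S_space_in_s[OF x t'], of p \<eta> p]
    by (simp add: pair_trunc_eq[OF x \<xi>])
  ultimately have "(\<lambda>i. adj_matrix x \<xi> i * cnj (\<eta> i)) sums pair \<xi> (x \<eta>)" by (simp add: sums_def)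
  then show ?thesis by (simp add: pair_def sums_iff)
qed

text \<open>On s', testing against unit sequences recovers every coordinate; off s' both operators
  take the default value 0.\<close>

lemma adjoint_unique:
  assumes x: "x \<in> S_space" and y: "y \<in> S_space"
    and eq: "\<And>\<xi> \<eta>. \<xi> \<in> s'_space \<Longrightarrow> \<eta> \<in> s'_space \<Longrightarrow> pair (y \<xi>) \<eta> = pair \<xi> (x \<eta>)"
  shows "y = adj_matrix x"
proof (rule ext)
  fix \<xi>
  show "y \<xi> = adj_matrix x \<xi>"
  proof (cases "\<xi> \<in> s'_space")
    case True
    then show ?thesis
      using eq[OF True unit_seq_s'_space] by (simp add: pair_unit_right adj_matrix_def fun_eq_iff)
  qed (simp add: S_space_outside[OF y] adj_matrix_def)
qed

lemma adjS_eq: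
  assumes x: "x \<in> S_space"
  shows "adjS x = adj_matrix x"
  unfolding adjS_def
proof (rule the_equality)
  show "adj_matrix x \<in> S_space \<and> (\<forall>\<xi>\<in>s'_space. \<forall>\<eta>\<in>s'_space. pair (adj_matrix x \<xi>) \<eta> = pair \<xi> (x \<eta>))"
    using adj_matrix_S_space[OF x] pair_adj_matrix[OF x] by blast
next
  fix y assume "y \<in> S_space \<and> (\<forall>\<xi>\<in>s'_space. \<forall>\<eta>\<in>s'_space. pair (y \<xi>) \<eta> = pair \<xi> (x \<eta>))"
  then show "y = adj_matrix x" by (intro adjoint_unique[OF x]) blast+
qed

section \<open>Properties of the involution\<close>

lemma adjS_S_space: "x \<in> S_space \<Longrightarrow> adjS x \<in> S_space"
  by (simp add: adjS_eq adj_matrix_S_space)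

lemma pair_adjS: "x \<in> S_space \<Longrightarrow> \<xi> \<in> s'_space \<Longrightarrow> \<eta> \<in> s'_space \<Longrightarrow> pair (adjS x \<xi>) \<eta> = pair \<xi> (x \<eta>)"
  by (simp add: adjS_eq pair_adj_matrix)

lemma adjS_apply: "x \<in> S_space \<Longrightarrow> \<xi> \<in> s'_space \<Longrightarrow> adjS x \<xi> i = pair \<xi> (x (unit_seq i))"
  by (simp add: adjS_eq adj_matrix_def)

lemma adjS_eqI:
  assumes "x \<in> S_space" "y \<in> S_space"
    and "\<And>\<xi> \<eta>. \<xi> \<in> s'_space \<Longrightarrow> \<eta> \<in> s'_space \<Longrightarrow> pair (y \<xi>) \<eta> = pair \<xi> (x \<eta>)"
  shows "adjS x = y"
  using adjoint_unique[OF assms] adjS_eq[OF assms(1)] by simp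

lemma pair_commute':
  assumes "\<xi> \<in> s'_space" "\<eta> \<in> s_space"
  shows "pair \<eta> \<xi> = cnj (pair \<xi> \<eta>)"
  by (rule pair_commute[OF pair_summable'[OF assms]])

lemma adjS_adjS:
  assumes x: "x \<in> S_space"
  shows "adjS (adjS x) = x"
proof (rule adjS_eqI[OF adjS_S_space[OF x] x])
  fix \<xi> \<eta> assume \<xi>: "\<xi> \<in> s'_space" and \<eta>: "\<eta> \<in> s'_space"
  show "pair (x \<xi>) \<eta> = pair \<xi> (adjS x \<eta>)"
    using pair_commute'[OF \<eta> S_space_in_s[OF x \<xi>]] pair_commute'[OF \<xi> S_space_in_s[OF adjS_S_space[OF x] \<eta>]]
      pair_adjS[OF x \<eta> \<xi>] by simp
qed

lemma adjS_addS:
  assumes x: "x \<in> S_space" and y: "y \<in> S_space"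
  shows "adjS (addS x y) = addS (adjS x) (adjS y)"
proof (rule adjS_eqI)
  fix \<xi> \<eta> assume \<xi>: "\<xi> \<in> s'_space" and \<eta>: "\<eta> \<in> s'_space"
  have "pair \<xi> (addS x y \<eta>) = pair \<xi> (x \<eta>) + pair \<xi> (y \<eta>)"
    unfolding addS_def using x y \<xi> \<eta> by (intro pair_add_right S_space_in_s)
  \<comment> \<open>Here the second argument lies only in s' and the first one in s, so
    \<open>pair_add_left\<close> does not apply; additivity is obtained by conjugating to the
    right-hand version.\<close>
  moreover have "pair (addS (adjS x) (adjS y) \<xi>) \<eta> = pair (adjS x \<xi>) \<eta> + pair (adjS y \<xi>) \<eta>"
  proof -
    have s: "adjS x \<xi> \<in> s_space" "adjS y \<xi> \<in> s_space"
      using x y \<xi> by (auto intro: S_space_in_s adjS_S_space)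
    have s': "(\<lambda>i. adjS x \<xi> i + adjS y \<xi> i) \<in> s_space"
      using s s_summable_add(1) by (simp add: s_space_iff)
    show ?thesis
      unfolding addS_def
      using pair_commute'[OF \<eta> s'] pair_commute'[OF \<eta> s(1)] pair_commute'[OF \<eta> s(2)] pair_add_right[OF \<eta> s]
      by simp
  qed
  ultimately show "pair (addS (adjS x) (adjS y) \<xi>) \<eta> = pair \<xi> (addS x y \<eta>)"
    using x y \<xi> \<eta> by (simp add: pair_adjS)
qed (use x y in \<open>auto intro: addS_S_space adjS_S_space\<close>)

lemma adjS_smulS:
  assumes x: "x \<in> S_space"
  shows "adjS (smulS c x) = smulS (cnj c) (adjS x)"
proof (rule ext, rule ext)
  fix \<xi> i
  show "adjS (smulS c x) \<xi> i = smulS (cnj c) (adjS x) \<xi> i"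
  proof (cases "\<xi> \<in> s'_space")
    case True
    show ?thesis
      using pair_scale_right[OF True S_space_in_s[OF x unit_seq_s'_space], of c i]
      by (simp add: adjS_apply True x smulS_S_space) (simp add: smulS_def adjS_apply True x)
  next
    case False
    then show ?thesis
      using S_space_outside[OF adjS_S_space[OF x] False]
        S_space_outside[OF adjS_S_space[OF smulS_S_space[OF x]] False] by (simp add: smulS_def)
  qed
qed

text \<open>The estimate behind the existence of the adjoint already has the constant
  \<open>opn n x\<close>. The involution thus preserves unit balls, so precomposing a map with it
  does not raise its norm.\<close>

lemma opn_adjS_le:
  assumes x: "x \<in> S_space" and n: "1 \<le> n"
  shows "opn n (adjS x) \<le> opn n x"
proof (rule opn_leI)
  fix \<xi> assume "\<xi> \<in> dball n"
  then have d: "d_summable n \<xi>" "dnorm n \<xi> \<le> 1" by (auto simp: dball_iff)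
  have "snorm n (adjS x \<xi>) \<le> opn n x * dnorm n \<xi>"
    using s_summableI(2)[OF adj_matrix_bound[OF x n d(1)]] by (simp add: adjS_eq x)
  also have "\<dots> \<le> opn n x" using mult_left_mono[OF d(2) opn_nonneg[OF x n]] by simp
  finally show "snorm n (adjS x \<xi>) \<le> opn n x" .
qed

text \<open>Taking adjoints exchanges the row sum and the column sum, and the maximum is
  symmetric.\<close>

lemma rcnorm_adjS:
  assumes "\<And>j. j < m \<Longrightarrow> xs j \<in> S_space"
  shows "rcnorm k (\<lambda>j. adjS (xs j)) m = rcnorm k xs m"
proof -
  have "sumS (\<lambda>j. mulS (adjS (adjS (xs j))) (adjS (xs j))) m = sumS (\<lambda>j. mulS (xs j) (adjS (xs j))) m"
    "sumS (\<lambda>j. mulS (adjS (xs j)) (adjS (adjS (xs j)))) m = sumS (\<lambda>j. mulS (adjS (xs j)) (xs j)) m"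
    using assms by (auto simp: sumS_def adjS_adjS intro!: ext sum.cong)
  then show ?thesis by (simp add: rcnorm_def max.commute)
qed

text \<open>A vanishing norm kills every column of the matrix, and the matrix determines the
  operator.\<close>

lemma zero_op_if_opn_zero:
  assumes x: "x \<in> S_space" and n: "1 \<le> n" and z: "opn n x = 0"
  shows "x = (\<lambda>\<xi> i. 0)"
proof (intro ext)
  fix \<xi> i
  show "x \<xi> i = 0"
  proof (cases "\<xi> \<in> s'_space")
    case True
    have "cmod (x (unit_seq k) i) \<le> 0" for k
      using order_trans[OF cmod_le_snorm snorm_le_opn[OF x n unit_seq_d(1)]]
        S_space_summable[OF x unit_seq_s'_space n] z by simp
    then show ?thesis using sums_unique[OF matrix_sums[OF x True, of i]] by simp
  qed (simp add: S_space_outside[OF x])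
qed

section \<open>The weighted trace state\<close>

text \<open>The square of \<open>hs_vec\<close> contributes w^(4n+2). The factor w^(-2) makes the
  weights summable and leaves w^(4n)/2, exactly half of what the Hilbert-Schmidt bound needs; this
  explains the index 2n+1.\<close>

definition hs_weight :: "nat \<Rightarrow> real" where "hs_weight k = 1 / (2 * (wt k)\<^sup>2)"
definition hs_vec :: "nat \<Rightarrow> nat \<Rightarrow> seqc" where
  "hs_vec n k = (\<lambda>i. complex_of_real (wt k ^ (2*n+1)) * unit_seq k i)"
definition hs_state :: "nat \<Rightarrow> opS \<Rightarrow> complex" where
  "hs_state n x = (\<Sum>k. complex_of_real (hs_weight k) * phiv (hs_vec n k) x)"

lemma hs_weight_nonneg [simp]: "0 \<le> hs_weight k"
  by (simp add: hs_weight_def)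

text \<open>Replacing one factor of the square by the preceding weight makes the sum telescope. The
  first term 1/2 starts the induction with equality.\<close>

lemma sum_hs_weight_le: "(\<Sum>k<p. hs_weight k) \<le> 1"
proof -
  have "(\<Sum>k<Suc p. hs_weight k) \<le> 1 - 1 / (2 * wt p)" for p
  proof (induction p)
    case 0
    then show ?case by (simp add: hs_weight_def wt_def)
  next
    case (Suc p)
    have "1 / (2 * (wt (Suc p))\<^sup>2) \<le> 1 / (2 * (wt p * wt (Suc p)))"
      by (rule divide_left_mono) (auto simp: wt_def power2_eq_square)
    also have "\<dots> = 1 / (2 * wt p) - 1 / (2 * wt (Suc p))"
      by (simp add: field_simps) (simp add: wt_def)
    finally show ?case using Suc by (simp add: hs_weight_def)
  qed
  note le = this
  show ?thesis
  proof (cases p)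
    case (Suc q)
    have "0 \<le> 1 / (2 * wt q)" by simp
    then show ?thesis using le[of q] unfolding Suc by linarith
  qed simp
qed

lemma phiv_bound:
  assumes x: "x \<in> S_space" and n: "1 \<le> n" and \<xi>: "\<xi> \<in> dball n"
  shows "cmod (phiv \<xi> x) \<le> opn n x"
proof -
  have d: "d_summable n \<xi>" "dnorm n \<xi> \<le> 1" using \<xi> by (auto simp: dball_iff)
  note \<xi>' = dball_s'[OF n \<xi>]
  have "cmod (phiv \<xi> x) = cmod (pair \<xi> (x \<xi>))"
    using pair_commute'[OF \<xi>' S_space_in_s[OF x \<xi>']] by (simp add: phiv_def)
  also have "\<dots> \<le> dnorm n \<xi> * snorm n (x \<xi>)"
    by (intro pair_summable d S_space_summable x n \<xi>')
  also have "\<dots> \<le> 1 * opn n x"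
    using d snorm_nonneg[OF S_space_summable[OF x \<xi>' n]] opn_upper[OF x n \<xi>] by (intro mult_mono) auto
  finally show ?thesis by simp
qed

lemma hs_vec_dball: "hs_vec n k \<in> dball (2*n+1)"
  using dnorm_scale[OF unit_seq_d(1), of "2*n+1" "complex_of_real (wt k ^ (2*n+1))" k]
    d_summable_scale[OF unit_seq_d(1), of "2*n+1" "complex_of_real (wt k ^ (2*n+1))" k]
  by (simp add: dball_iff hs_vec_def unit_seq_d norm_mult norm_power)

lemma hs_vec_s': "hs_vec n k \<in> s'_space"
  by (rule dball_s'[OF _ hs_vec_dball[of n]]) simp

text \<open>Each vector functional is bounded by \<open>opn (2*n+1) x\<close>, and the weights have
  total mass at most 1, so the series converges absolutely with the same bound.\<close>

lemma hs_state_bound: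
  assumes x: "x \<in> S_space"
  shows "(\<lambda>k. complex_of_real (hs_weight k) * phiv (hs_vec n k) x) sums hs_state n x"
    and "cmod (hs_state n x) \<le> opn (2*n+1) x"
proof -
  have le: "(\<Sum>k<p. cmod (complex_of_real (hs_weight k) * phiv (hs_vec n k) x)) \<le> opn (2*n+1) x" for p
  proof -
    have "(\<Sum>k<p. cmod (complex_of_real (hs_weight k) * phiv (hs_vec n k) x))
        \<le> (\<Sum>k<p. hs_weight k * opn (2*n+1) x)"
      by (intro sum_mono) (use phiv_bound[OF x _ hs_vec_dball] in \<open>auto simp: norm_mult intro!: mult_left_mono\<close>)
    also have "\<dots> \<le> 1 * opn (2*n+1) x"
      unfolding sum_distrib_right[symmetric]
      by (intro mult_right_mono sum_hs_weight_le opn_nonneg x) simp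
    finally show ?thesis by simp
  qed
  have 1: "summable (\<lambda>k. cmod (complex_of_real (hs_weight k) * phiv (hs_vec n k) x))"
    by (rule summableI_nonneg_bounded[OF _ le]) simp
  show "(\<lambda>k. complex_of_real (hs_weight k) * phiv (hs_vec n k) x) sums hs_state n x"
    unfolding hs_state_def by (rule summable_sums[OF summable_norm_cancel[OF 1]])
  show "cmod (hs_state n x) \<le> opn (2*n+1) x"
    unfolding hs_state_def by (rule order_trans[OF summable_norm[OF 1] suminf_le_const[OF 1 le]])
qed

lemma phiv_addS:
  assumes "x \<in> S_space" "y \<in> S_space" "\<xi> \<in> s'_space"
  shows "phiv \<xi> (addS x y) = phiv \<xi> x + phiv \<xi> y"
proof -
  have s: "x \<xi> \<in> s_space" "y \<xi> \<in> s_space" "addS x y \<xi> \<in> s_space"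
    using assms by (auto intro: S_space_in_s addS_S_space)
  show ?thesis
    using pair_commute'[OF assms(3) s(1)] pair_commute'[OF assms(3) s(2)] pair_commute'[OF assms(3) s(3)]
      pair_add_right[OF assms(3) s(1,2)]
    by (simp add: phiv_def addS_def)
qed

lemma phiv_smulS:
  assumes "x \<in> S_space" "\<xi> \<in> s'_space"
  shows "phiv \<xi> (smulS c x) = c * phiv \<xi> x"
proof -
  have s: "x \<xi> \<in> s_space" "smulS c x \<xi> \<in> s_space"
    using assms by (auto intro: S_space_in_s smulS_S_space)
  show ?thesis
    using pair_commute'[OF assms(2) s(1)] pair_commute'[OF assms(2) s(2)]
      pair_scale_right[OF assms(2) s(1), of c]
    by (simp add: phiv_def smulS_def)
qed

lemma hs_state_addS:
  assumes "x \<in> S_space" "y \<in> S_space"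
  shows "hs_state n (addS x y) = hs_state n x + hs_state n y"
  using sums_add[OF hs_state_bound(1)[OF assms(1), of n] hs_state_bound(1)[OF assms(2), of n]]
  unfolding hs_state_def by (simp add: phiv_addS assms hs_vec_s' sums_iff distrib_left)

lemma hs_state_smulS:
  assumes "x \<in> S_space"
  shows "hs_state n (smulS c x) = c * hs_state n x"
  using sums_mult[OF hs_state_bound(1)[OF assms(1), of n], of c]
  unfolding hs_state_def by (simp add: phiv_smulS assms hs_vec_s' sums_iff mult.left_commute)

text \<open>The weights add up to less than \<open>1\<close>; the missing mass is put on \<open>\<phi>\<^sub>0 = 0\<close>.\<close>

lemma nstate_hs_state: "nstate (2*n+1) (hs_state n)"
proof -
  have dual: "dual_S (hs_state n)"
    unfolding dual_S_def
  proof (intro conjI)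
    show "\<exists>N\<ge>1. \<exists>C. \<forall>x\<in>S_space. cmod (hs_state n x) \<le> C * opn N x"
      using hs_state_bound(2)[of _ n] by (intro exI[of _ "2*n+1"] conjI exI[of _ 1]) auto
  qed (use hs_state_addS hs_state_smulS in auto)
  show ?thesis
    unfolding nstate_def
  proof (intro conjI dual allI impI, elim conjE)
    fix F :: "opS set" and e :: real
    assume F: "finite F" "F \<subseteq> S_space" and e: "0 < e"
    have "\<forall>\<^sub>F p in sequentially. cmod (hs_state n x - (\<Sum>k<p. complex_of_real (hs_weight k) * phiv (hs_vec n k) x)) < e"
      if x: "x \<in> F" for x
    proof -
      have "(\<lambda>p. \<Sum>k<p. complex_of_real (hs_weight k) * phiv (hs_vec n k) x) \<longlonglongrightarrow> hs_state n x"
        using hs_state_bound(1)[of x n] x F by (auto simp: sums_def)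
      from tendstoD[OF this e] show ?thesis by (simp add: dist_norm norm_minus_commute)
    qed
    then have "\<forall>\<^sub>F p in sequentially. \<forall>x\<in>F.
        cmod (hs_state n x - (\<Sum>k<p. complex_of_real (hs_weight k) * phiv (hs_vec n k) x)) < e"
      using F(1) by (intro eventually_ball_finite) auto
    then obtain p where p: "\<forall>x\<in>F. cmod (hs_state n x - (\<Sum>k<p. complex_of_real (hs_weight k) * phiv (hs_vec n k) x)) < e"
      by (auto simp: eventually_sequentially)
    define a where "a i = (if i < p then hs_weight i else 1 - (\<Sum>k<p. hs_weight k))" for i
    define \<xi>s where "\<xi>s i = (if i < p then hs_vec n i else (\<lambda>_. 0))" for i
    have "phiv (\<lambda>_. 0) x = 0" for x by (simp add: phiv_def pair_def)
    then have "(\<Sum>i<Suc p. complex_of_real (a i) * phiv (\<xi>s i) x)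
        = (\<Sum>k<p. complex_of_real (hs_weight k) * phiv (hs_vec n k) x)" for x
      by (simp add: a_def \<xi>s_def)
    moreover have "(\<Sum>i<Suc p. a i) = 1" by (simp add: a_def)
    moreover have "\<forall>i<Suc p. 0 \<le> a i \<and> \<xi>s i \<in> dball (2*n+1)"
      using sum_hs_weight_le[of p] hs_vec_dball[of n] zero_in_dball by (auto simp: a_def \<xi>s_def)
    ultimately show "\<exists>p (a::nat \<Rightarrow> real) \<xi>s. (\<forall>i<p. 0 \<le> a i \<and> \<xi>s i \<in> dball (2*n+1)) \<and> (\<Sum>i<p. a i) = 1 \<and>
        (\<forall>x\<in>F. cmod (hs_state n x - (\<Sum>i<p. complex_of_real (a i) * phiv (\<xi>s i) x)) < e)"
      using p by (intro exI[of _ "Suc p"] exI[of _ a] exI[of _ \<xi>s]) presburger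
  qed
qed

section \<open>Hilbert--Schmidt domination of the operator norm\<close>

text \<open>Cauchy-Schwarz in each row of the matrix weighted on both sides, first for truncations
  of \<xi>. The hypothesis involves finite blocks only, so no double series occurs.\<close>

lemma opn_le_hilbert_schmidt:
  assumes x: "x \<in> S_space" and n: "1 \<le> n" and B: "0 \<le> B"
    and le: "\<And>p q. (\<Sum>i<q. \<Sum>k<p. wt i ^ (2*n) * wt k ^ (2*n) * (cmod (x (unit_seq k) i))\<^sup>2) \<le> B\<^sup>2"
  shows "opn n x \<le> B"
proof (rule opn_leI)
  fix \<xi> assume \<xi>: "\<xi> \<in> dball n"
  then have d: "d_summable n \<xi>" "dnorm n \<xi> \<le> 1" by (auto simp: dball_iff)
  have trunc: "L2_set (\<lambda>i. cmod (x (trunc p \<xi>) i) * wt i ^ n) {..<q} \<le> B" for p q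
  proof -
    have "cmod (x (trunc p \<xi>) i) * wt i ^ n \<le> L2_set (\<lambda>k. wt i ^ n * wt k ^ n * cmod (x (unit_seq k) i)) {..<p}" for i
    proof -
      have "cmod (x (trunc p \<xi>) i) * wt i ^ n \<le> (\<Sum>k<p. cmod (\<xi> k * x (unit_seq k) i)) * wt i ^ n"
        unfolding S_space_trunc[OF x] by (intro mult_right_mono norm_sum) simp
      also have "\<dots> = (\<Sum>k<p. \<bar>cmod (\<xi> k) / wt k ^ n\<bar> * \<bar>wt i ^ n * wt k ^ n * cmod (x (unit_seq k) i)\<bar>)"
        unfolding sum_distrib_right by (intro sum.cong) (auto simp: norm_mult)
      also have "\<dots> \<le> L2_set (\<lambda>k. cmod (\<xi> k) / wt k ^ n) {..<p}
          * L2_set (\<lambda>k. wt i ^ n * wt k ^ n * cmod (x (unit_seq k) i)) {..<p}"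
        by (rule L2_set_mult_ineq)
      also have "\<dots> \<le> 1 * L2_set (\<lambda>k. wt i ^ n * wt k ^ n * cmod (x (unit_seq k) i)) {..<p}"
        by (intro mult_right_mono order_trans[OF L2_set_le_dnorm[OF d(1)] d(2)]) simp
      finally show ?thesis by simp
    qed
    then have "L2_set (\<lambda>i. cmod (x (trunc p \<xi>) i) * wt i ^ n) {..<q}
        \<le> L2_set (\<lambda>i. L2_set (\<lambda>k. wt i ^ n * wt k ^ n * cmod (x (unit_seq k) i)) {..<p}) {..<q}"
      by (intro L2_set_mono) auto
    also have "\<dots> = sqrt (\<Sum>i<q. \<Sum>k<p. wt i ^ (2*n) * wt k ^ (2*n) * (cmod (x (unit_seq k) i))\<^sup>2)"
      by (simp add: L2_set_def sum_nonneg power_mult_distrib power_mult[symmetric] mult.commute[of 2])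
    also have "\<dots> \<le> sqrt (B\<^sup>2)" by (intro real_sqrt_le_mono le)
    finally show ?thesis using B by simp
  qed
  \<comment> \<open>With q fixed only finitely many coordinates matter, so coordinatewise
    convergence of the truncations is enough.\<close>
  have "L2_set (\<lambda>i. cmod (x \<xi> i) * wt i ^ n) {..<q} \<le> B" for q
  proof (rule LIMSEQ_le_const2)
    show "(\<lambda>p. L2_set (\<lambda>i. cmod (x (trunc p \<xi>) i) * wt i ^ n) {..<q})
        \<longlonglongrightarrow> L2_set (\<lambda>i. cmod (x \<xi> i) * wt i ^ n) {..<q}"
      unfolding L2_set_def S_space_trunc[OF x]
      by (intro tendsto_intros matrix_sums[OF x dball_s'[OF n \<xi>], unfolded sums_def])
  qed (use trunc in auto)
  then show "snorm n (x \<xi>) \<le> B" by (rule s_summableI)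
qed

lemma Re_pair_self_ge:
  assumes "\<eta> \<in> s_space"
  shows "(\<Sum>i<q. (cmod (\<eta> i))\<^sup>2) \<le> Re (pair \<eta> \<eta>)"
proof -
  have "(\<lambda>i. Re (\<eta> i * cnj (\<eta> i))) sums Re (pair \<eta> \<eta>)"
    by (intro sums_Re pair_sums s_subset_s' assms)
  moreover have "Re (\<eta> i * cnj (\<eta> i)) = (cmod (\<eta> i))\<^sup>2" for i
    by (simp flip: complex_norm_square)
  ultimately have "(\<lambda>i. (cmod (\<eta> i))\<^sup>2) sums Re (pair \<eta> \<eta>)" by simp
  then show ?thesis using sum_le_suminf[of "\<lambda>i. (cmod (\<eta> i))\<^sup>2" "{..<q}"] by (simp add: sums_iff)
qed

text \<open>The adjoint relation turns each term of the state at \<open>mulS (adjS x) x\<close> into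
  the squared l2 norm of a scaled column of x.\<close>

lemma Re_hs_state_ge:
  assumes x: "x \<in> S_space"
  shows "(\<Sum>k<p. \<Sum>i<q. wt k ^ (4*n) / 2 * (cmod (x (unit_seq k) i))\<^sup>2) \<le> Re (hs_state n (mulS (adjS x) x))"
proof -
  define t where "t k = hs_weight k * Re (phiv (hs_vec n k) (mulS (adjS x) x))" for k
  have ge: "(\<Sum>i<q. wt k ^ (4*n) / 2 * (cmod (x (unit_seq k) i))\<^sup>2) \<le> t k" for k q
  proof -
    have s: "x (hs_vec n k) \<in> s_space" using hs_vec_s' S_space_in_s[OF x] by blast
    have v: "x (hs_vec n k) = (\<lambda>i. complex_of_real (wt k ^ (2*n+1)) * x (unit_seq k) i)"
      unfolding hs_vec_def by (rule S_space_scale[OF x unit_seq_s'_space])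
    have "phiv (hs_vec n k) (mulS (adjS x) x) = pair (x (hs_vec n k)) (x (hs_vec n k))"
      using pair_adjS[OF x s_subset_s'[OF s] hs_vec_s'] by (simp add: phiv_def mulS_def)
    then have "hs_weight k * (\<Sum>i<q. (cmod (x (hs_vec n k) i))\<^sup>2) \<le> t k"
      unfolding t_def using Re_pair_self_ge[OF s] by (intro mult_left_mono) auto
    moreover have "hs_weight k * (\<Sum>i<q. (cmod (x (hs_vec n k) i))\<^sup>2)
        = (\<Sum>i<q. wt k ^ (4*n) / 2 * (cmod (x (unit_seq k) i))\<^sup>2)"
    proof -
      have "hs_weight k * (cmod (x (hs_vec n k) i))\<^sup>2 = wt k ^ (4*n) / 2 * (cmod (x (unit_seq k) i))\<^sup>2" for i
      proof -
        have "(wt k ^ (2*n+1))\<^sup>2 = wt k ^ (4*n) * (wt k)\<^sup>2"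
          by (simp add: power_mult[symmetric] power_add[symmetric] flip: power_Suc)
        then show ?thesis
          unfolding v hs_weight_def norm_mult power_mult_distrib norm_of_real
          by (simp add: power_mult_distrib[symmetric] abs_mult)
      qed
      then show ?thesis unfolding sum_distrib_left by (intro sum.cong refl)
    qed
    ultimately show ?thesis by simp
  qed
  have "(\<lambda>k. Re (complex_of_real (hs_weight k) * phiv (hs_vec n k) (mulS (adjS x) x)))
      sums Re (hs_state n (mulS (adjS x) x))"
    by (intro sums_Re hs_state_bound(1) mulS_S_space adjS_S_space x)
  then have "t sums Re (hs_state n (mulS (adjS x) x))" by (simp add: t_def[abs_def])
  \<comment> \<open>The instance of \<open>ge\<close> with q = 0 has an empty left side and shows
    that the terms are nonnegative.\<close>
  then have "(\<Sum>k<p. t k) \<le> Re (hs_state n (mulS (adjS x) x))"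
    using ge[of _ 0] sum_le_suminf[of t "{..<p}"] by (simp add: sums_iff)
  then show ?thesis using sum_mono[of "{..<p}", OF ge] by (rule order_trans[rotated])
qed

lemma adjS_unit_seq:
  assumes x: "x \<in> S_space"
  shows "cmod (adjS x (unit_seq i) k) = cmod (x (unit_seq k) i)"
  using pair_commute'[OF unit_seq_s'_space S_space_in_s[OF x unit_seq_s'_space], of k i]
  by (simp add: adjS_apply x unit_seq_s'_space pair_unit_right)

text \<open>After the arithmetic-geometric inequality, the half with column weights is controlled by
  \<open>mulS (adjS x) x\<close>. The half with row weights is the same statement for
  \<open>adjS x\<close>, whose entries have the transposed moduli.\<close>

lemma opn_sq_le_hs_state:
  assumes x: "x \<in> S_space" and n: "1 \<le> n"
  shows "(opn n x)\<^sup>2 \<le> Re (hs_state n (mulS (adjS x) x) + hs_state n (mulS x (adjS x)))" (is "_ \<le> ?R")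
proof -
  have le: "(\<Sum>i<q. \<Sum>k<p. wt i ^ (2*n) * wt k ^ (2*n) * (cmod (x (unit_seq k) i))\<^sup>2) \<le> ?R" for p q
  proof -
    have amgm: "wt i ^ (2*n) * wt k ^ (2*n) \<le> wt k ^ (4*n) / 2 + wt i ^ (4*n) / 2" for i k
      using sum_squares_bound[of "wt i ^ (2*n)" "wt k ^ (2*n)"] by (simp add: power_mult[symmetric])
    have "(\<Sum>i<q. \<Sum>k<p. wt i ^ (2*n) * wt k ^ (2*n) * (cmod (x (unit_seq k) i))\<^sup>2)
        \<le> (\<Sum>i<q. \<Sum>k<p. (wt k ^ (4*n) / 2 + wt i ^ (4*n) / 2) * (cmod (x (unit_seq k) i))\<^sup>2)"
      by (intro sum_mono mult_right_mono amgm) simp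
    also have "\<dots> = (\<Sum>k<p. \<Sum>i<q. wt k ^ (4*n) / 2 * (cmod (x (unit_seq k) i))\<^sup>2)
        + (\<Sum>i<q. \<Sum>k<p. wt i ^ (4*n) / 2 * (cmod (x (unit_seq k) i))\<^sup>2)"
      by (simp only: distrib_right sum.distrib) (rule arg_cong2[where f="(+)", OF sum.swap refl])
    also have "\<dots> \<le> ?R"
      using add_mono[OF Re_hs_state_ge[OF x, of n q p] Re_hs_state_ge[OF adjS_S_space[OF x], of n p q]]
      by (simp add: adjS_adjS x adjS_unit_seq)
    finally show ?thesis .
  qed
  have R: "0 \<le> ?R" using le[of 0 0] by simp
  have "opn n x \<le> sqrt ?R"
    by (rule opn_le_hilbert_schmidt[OF x n]) (use R le in simp_all)
  then have "(opn n x)\<^sup>2 \<le> (sqrt ?R)\<^sup>2" by (intro power_mono opn_nonneg x n)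
  then show ?thesis using R by simp
qed

lemma hs_state_sumS:
  "(\<And>j. j < m \<Longrightarrow> f j \<in> S_space) \<Longrightarrow> hs_state n (sumS f m) = (\<Sum>j<m. hs_state n (f j))"
proof (induction m)
  case 0
  have "sumS f 0 = smulS 0 (\<lambda>\<xi> i. 0)" by (simp add: sumS_def smulS_def)
  then show ?case using hs_state_smulS[OF zero_S_space] by simp
next
  case (Suc m)
  then show ?case by (simp add: sumS_Suc hs_state_addS sumS_S_space)
qed

lemma rcnorm_nonneg:
  assumes "\<And>j. j < m \<Longrightarrow> xs j \<in> S_space" "1 \<le> k"
  shows "0 \<le> rcnorm k xs m"
  unfolding rcnorm_def using assms
  by (intro max.coboundedI1 real_sqrt_ge_zero opn_nonneg sumS_S_space mulS_S_space adjS_S_space)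

text \<open>Linearity of the state collects the family into its row and column sums before the state
  is bounded by the norm; the factor 2 counts these two sums.\<close>

lemma sum_opn_sq_le:
  assumes xs: "\<And>j. j < m \<Longrightarrow> xs j \<in> S_space" and n: "1 \<le> n"
  shows "(\<Sum>j<m. (opn n (xs j))\<^sup>2) \<le> 2 * (rcnorm (2*n+1) xs m)\<^sup>2"
proof -
  let ?z1 = "sumS (\<lambda>j. mulS (adjS (xs j)) (xs j)) m" and ?z2 = "sumS (\<lambda>j. mulS (xs j) (adjS (xs j))) m"
  have S: "?z1 \<in> S_space" "?z2 \<in> S_space"
    using xs by (auto intro!: sumS_S_space mulS_S_space adjS_S_space)
  have "(\<Sum>j<m. (opn n (xs j))\<^sup>2)
      \<le> (\<Sum>j<m. Re (hs_state n (mulS (adjS (xs j)) (xs j)) + hs_state n (mulS (xs j) (adjS (xs j)))))"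
    using xs n by (intro sum_mono opn_sq_le_hs_state) auto
  also have "\<dots> = Re (hs_state n ?z1) + Re (hs_state n ?z2)"
    using xs by (simp add: hs_state_sumS mulS_S_space adjS_S_space sum.distrib)
  also have "\<dots> \<le> opn (2*n+1) ?z1 + opn (2*n+1) ?z2"
    by (intro add_mono order_trans[OF complex_Re_le_cmod hs_state_bound(2)] S)
  also have "\<dots> \<le> 2 * (rcnorm (2*n+1) xs m)\<^sup>2"
  proof -
    have "opn (2*n+1) z \<le> (rcnorm (2*n+1) xs m)\<^sup>2"
      if "z \<in> S_space" "sqrt (opn (2*n+1) z) \<le> rcnorm (2*n+1) xs m" for z
      using power_mono[OF that(2), of 2] opn_nonneg[OF that(1), of "2*n+1"] by simp
    from this[OF S(1)] this[OF S(2)] show ?thesis by (simp add: rcnorm_def)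
  qed
  finally show ?thesis .
qed

section \<open>The Grothendieck constant\<close>

text \<open>In \<open>ereal\<close>, \<open>\<infinity> * 0 = 0\<close>: an infinite norm makes a bound trivial only if the other factors are
  nonzero.\<close>

lemma ereal_le_timesI:
  assumes "0 < C" "0 \<le> a" "0 \<le> t" "t = 0 \<Longrightarrow> L \<le> 0" "\<And>\<alpha>. a = ereal \<alpha> \<Longrightarrow> L \<le> C * \<alpha> * t"
  shows "ereal L \<le> ereal C * a * ereal t"
  using assms by (cases a; cases "t = 0") auto

text \<open>Serves the case of an infinite \<open>bnorm\<close>: an operator of norm 0 is the zero
  operator, hence equal to \<open>smulS 0\<close> of itself.\<close>

lemma cont_bilinear_zero:
  assumes u: "cont_bilinear u" and x: "x \<in> S_space" and y: "y \<in> S_space" and n: "1 \<le> n"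
    and z: "opn n x = 0 \<or> opn n y = 0"
  shows "u x y = 0"
proof -
  have s: "u (smulS 0 x) y = 0 \<and> u x (smulS 0 y) = 0"
    using u x y unfolding cont_bilinear_def by (metis mult_zero_left)
  have "smulS 0 w = w" if "w \<in> S_space" "opn n w = 0" for w
    using zero_op_if_opn_zero[OF that(1) n that(2)] by (simp add: smulS_def)
  then show ?thesis using z s x y by metis
qed

text \<open>The normalization is carried out one variable at a time: fact \<open>2\<close> frees the
  first argument with the second still in the unit ball.\<close>

lemma cont_bilinear_bound:
  assumes u: "cont_bilinear u" and b: "bnorm n u \<le> ereal b" and n: "1 \<le> n"
    and x: "x \<in> S_space" and y: "y \<in> S_space"
  shows "cmod (u x y) \<le> b * opn n x * opn n y"
proof -
  have hom: "u (smulS c z) w = c * u z w" "u z (smulS c w) = c * u z w"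
    if "z \<in> S_space" "w \<in> S_space" for c z w
    using u that unfolding cont_bilinear_def by blast+
  have 1: "cmod (u z w) \<le> b" if "z \<in> S_space" "w \<in> S_space" "opn n z \<le> 1" "opn n w \<le> 1" for z w
  proof -
    have "ereal (cmod (u z w)) \<le> bnorm n u"
      unfolding bnorm_def using that by (intro SUP_upper2[where i="(z, w)"]) auto
    with b show ?thesis using order_trans by fastforce
  qed
  have 2: "cmod (u z w) \<le> b * opn n z" if "z \<in> S_space" "w \<in> S_space" "opn n w \<le> 1" for z w
    using that by (intro le_opn_if_le_on_unit_ball[where f="\<lambda>z. cmod (u z w)"] n 1)
      (auto simp: hom norm_mult)
  show ?thesis
    using x y by (intro le_opn_if_le_on_unit_ball[where f="\<lambda>w. cmod (u x w)"] n 2)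
      (auto simp: hom norm_mult)
qed

lemma bnorm_nonneg: "0 \<le> bnorm n u"
proof -
  have "opn n (\<lambda>\<xi> i. 0) \<le> 1" by (rule opn_leI) (simp add: snorm_def)
  then show ?thesis
    unfolding bnorm_def using zero_S_space
    by (intro SUP_upper2[where i="(\<lambda>\<xi> i. 0, \<lambda>\<xi> i. 0)"]) auto
qed

text \<open>The set inside \<open>Kn\<close>, named so that the rules for infima can be fed its
  lower bound 0 and its member 2.\<close>

definition grothendieck_consts :: "nat \<Rightarrow> real set" where
  "grothendieck_consts n = {C. 0 \<le> C \<and> (\<forall>u. cont_bilinear u \<longrightarrow> (\<forall>m xs ys.
      (\<forall>j<m. xs j \<in> S_space \<and> ys j \<in> S_space) \<longrightarrow>
      ereal (cmod (\<Sum>j<m. u (xs j) (ys j)))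
        \<le> ereal C * bnorm n u * ereal (rcnorm (2*n+1) xs m) * ereal (rcnorm (2*n+1) ys m)))}"

lemma grothendieck_constsD:
  assumes "C \<in> grothendieck_consts n" "cont_bilinear u"
    and "\<And>j. j < m \<Longrightarrow> xs j \<in> S_space \<and> ys j \<in> S_space"
  shows "ereal (cmod (\<Sum>j<m. u (xs j) (ys j)))
    \<le> ereal C * bnorm n u * ereal (rcnorm (2*n+1) xs m) * ereal (rcnorm (2*n+1) ys m)"
  using assms unfolding grothendieck_consts_def by blast

lemma Kn_eq: "Kn n = Inf (grothendieck_consts n)"
  by (simp add: Kn_def grothendieck_consts_def)

text \<open>If one \<open>rcnorm\<close> vanishes, \<open>sum_opn_sq_le\<close> forces every member
  of that family to have norm 0.\<close>

lemma sum_bilinear_zero: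
  assumes u: "cont_bilinear u" and n: "1 \<le> n"
    and S: "\<And>j. j < m \<Longrightarrow> xs j \<in> S_space \<and> ys j \<in> S_space"
    and z: "rcnorm (2*n+1) xs m * rcnorm (2*n+1) ys m = 0"
  shows "(\<Sum>j<m. u (xs j) (ys j)) = 0"
proof -
  have vanish: "opn n (zs j) = 0"
    if "rcnorm (2*n+1) zs m = 0" "\<And>j. j < m \<Longrightarrow> zs j \<in> S_space" "j < m" for zs j
  proof -
    have "(\<Sum>j<m. (opn n (zs j))\<^sup>2) \<le> 0" using sum_opn_sq_le[of m zs, OF that(2) n] that(1) by simp
    then have "(\<Sum>j<m. (opn n (zs j))\<^sup>2) = 0" by (intro antisym sum_nonneg) auto
    then show ?thesis using that(3) by (simp add: sum_nonneg_eq_0_iff)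
  qed
  show ?thesis
    using z vanish[of xs] vanish[of ys] S
    by (intro sum.neutral ballI cont_bilinear_zero[OF u _ _ n]) auto
qed

lemma two_in_grothendieck_consts:
  assumes n: "1 \<le> n"
  shows "2 \<in> grothendieck_consts n"
  unfolding grothendieck_consts_def
proof (intro CollectI conjI allI impI)
  fix u m and xs ys :: "nat \<Rightarrow> opS"
  assume u: "cont_bilinear u" and S: "\<forall>j<m. xs j \<in> S_space \<and> ys j \<in> S_space"
  let ?r = "rcnorm (2*n+1) xs m" and ?s = "rcnorm (2*n+1) ys m"
  have r: "0 \<le> ?r" and s: "0 \<le> ?s" using S by (auto intro!: rcnorm_nonneg)
  \<comment> \<open>Each family contributes one factor sqrt 2 from \<open>sum_opn_sq_le\<close>;
    their product is the constant 2.\<close>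
  have L2: "L2_set (\<lambda>j. opn n (xs j)) {..<m} \<le> sqrt 2 * ?r" "L2_set (\<lambda>j. opn n (ys j)) {..<m} \<le> sqrt 2 * ?s"
    using sum_opn_sq_le[of m xs n] sum_opn_sq_le[of m ys n] S n r s
    by (auto simp: L2_set_def real_sqrt_mult intro!: real_le_lsqrt simp: power_mult_distrib)
  have "cmod (\<Sum>j<m. u (xs j) (ys j)) \<le> 2 * b * (?r * ?s)" if b: "bnorm n u = ereal b" for b
  proof -
    have b0: "0 \<le> b" using bnorm_nonneg[of n u] b by simp
    have "cmod (\<Sum>j<m. u (xs j) (ys j)) \<le> (\<Sum>j<m. cmod (u (xs j) (ys j)))"
      by (rule norm_sum)
    also have "\<dots> \<le> (\<Sum>j<m. b * (\<bar>opn n (xs j)\<bar> * \<bar>opn n (ys j)\<bar>))"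
    proof (intro sum_mono)
      fix j assume "j \<in> {..<m}"
      then show "cmod (u (xs j) (ys j)) \<le> b * (\<bar>opn n (xs j)\<bar> * \<bar>opn n (ys j)\<bar>)"
        using S cont_bilinear_bound[OF u _ n, of b "xs j" "ys j"] b n by (simp add: opn_nonneg mult.assoc)
    qed
    also have "\<dots> \<le> b * (L2_set (\<lambda>j. opn n (xs j)) {..<m} * L2_set (\<lambda>j. opn n (ys j)) {..<m})"
      unfolding sum_distrib_left[symmetric] by (intro mult_left_mono L2_set_mult_ineq b0)
    also have "\<dots> \<le> b * ((sqrt 2 * ?r) * (sqrt 2 * ?s))"
      using r by (intro mult_left_mono mult_mono L2 b0) auto
    also have "\<dots> = 2 * b * (?r * ?s)" by simp
    finally show ?thesis .
  qed
  moreover have "cmod (\<Sum>j<m. u (xs j) (ys j)) \<le> 0" if "?r * ?s = 0"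
    using sum_bilinear_zero[OF u n _ that] S by simp
  ultimately have "ereal (cmod (\<Sum>j<m. u (xs j) (ys j))) \<le> ereal 2 * bnorm n u * ereal (?r * ?s)"
    using r s by (intro ereal_le_timesI bnorm_nonneg) auto
  then show "ereal (cmod (\<Sum>j<m. u (xs j) (ys j))) \<le> ereal 2 * bnorm n u * ereal ?r * ereal ?s"
    by (simp add: mult.assoc)
qed simp

lemma bdd_below_grothendieck_consts: "bdd_below (grothendieck_consts n)"
  by (rule bdd_belowI[of _ 0]) (simp add: grothendieck_consts_def)

lemma Kn_le_K:
  assumes "1 \<le> n"
  shows "Kn n \<le> K"
  unfolding K_def
proof (rule cSup_upper)
  have "Kn n \<le> 2" if "1 \<le> n" for n
    unfolding Kn_eq by (rule cInf_lower[OF two_in_grothendieck_consts[OF that] bdd_below_grothendieck_consts])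
  then show "bdd_above (Kn ` {1..})" by (intro bdd_aboveI2[of _ _ 2]) auto
qed (use assms in simp)

section \<open>The first matrix unit and the lower bound for the constants\<close>

definition E00 :: opS where
  "E00 \<xi> = (if \<xi> \<in> s'_space then (\<lambda>i. \<xi> 0 * unit_seq 0 i) else (\<lambda>i. 0))"

text \<open>The weight at position 0 is 1, so this projection is contractive at every index
  simultaneously.\<close>

lemma snorm_E00:
  assumes "1 \<le> n" "d_summable n \<xi>"
  shows "s_summable n (E00 \<xi>)" "snorm n (E00 \<xi>) \<le> dnorm n \<xi>"
proof -
  have "cmod (\<xi> 0) / wt 0 ^ n \<le> L2_set (\<lambda>i. cmod (\<xi> i) / wt i ^ n) {..<1}"
    by (rule member_le_L2_set) auto
  also have "\<dots> \<le> dnorm n \<xi>" by (rule L2_set_le_dnorm[OF assms(2)])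
  finally have "cmod (\<xi> 0) \<le> dnorm n \<xi>" by (simp add: wt_def)
  then show "s_summable n (E00 \<xi>)" "snorm n (E00 \<xi>) \<le> dnorm n \<xi>"
    using d_summable_s'[OF assms] s_summable_scale[OF unit_seq_s(1), of n "\<xi> 0" 0]
      snorm_scale[OF unit_seq_s(1), of n "\<xi> 0" 0] by (auto simp: E00_def unit_seq_s wt_def)
qed

lemma E00_S_space: "E00 \<in> S_space"
proof (rule S_spaceI)
  fix n :: nat assume "1 \<le> n"
  then show "\<exists>B\<ge>0. \<forall>\<xi>. d_summable n \<xi> \<longrightarrow> s_summable n (E00 \<xi>) \<and> snorm n (E00 \<xi>) \<le> B * dnorm n \<xi>"
    using snorm_E00 by (intro exI[of _ 1]) auto
qed (auto simp: E00_def s'_space_add s'_space_scale algebra_simps)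

lemma opn_E00_le: "1 \<le> n \<Longrightarrow> opn n E00 \<le> 1"
  using snorm_E00(2) order_trans by (intro opn_leI) (fastforce simp: dball_iff)

lemma E00_E00: "mulS E00 E00 = E00"
proof
  fix \<xi>
  \<comment> \<open>Covers \<xi> outside s': the inner application then returns the zero sequence,
    which lies in s'.\<close>
  have "(\<lambda>i. 0 :: complex) \<in> s'_space" using s'_space_scale[OF unit_seq_s'_space, of 0] by simp
  then show "mulS E00 E00 \<xi> = E00 \<xi>"
    using s'_space_scale[OF unit_seq_s'_space] by (simp add: mulS_def E00_def) (simp add: unit_seq_def)
qed

lemma adjS_E00: "adjS E00 = E00"
proof (rule adjS_eqI[OF E00_S_space E00_S_space])
  fix \<xi> \<eta> assume \<xi>: "\<xi> \<in> s'_space" and \<eta>: "\<eta> \<in> s'_space"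
  show "pair (E00 \<xi>) \<eta> = pair \<xi> (E00 \<eta>)"
    using pair_commute'[OF \<eta> S_space_in_s[OF E00_S_space \<xi>]] \<xi> \<eta>
    by (simp add: E00_def pair_scale_right unit_seq_s_space pair_unit_right)
qed

text \<open>The form \<open>(x, y) \<mapsto> x\<^sub>1\<^sub>1 y\<^sub>1\<^sub>1\<close>, tested on the matrix unit, shows \<open>K\<^sub>n \<ge> 1\<close>.\<close>

lemma one_le_Kn:
  assumes n: "1 \<le> n"
  shows "1 \<le> Kn n"
  unfolding Kn_eq
proof (rule cInf_greatest)
  show "grothendieck_consts n \<noteq> {}" using two_in_grothendieck_consts[OF n] by blast
  fix C assume C: "C \<in> grothendieck_consts n"
  define c where "c x = x (unit_seq 0) 0" for x :: opS
  define u where "u x y = c x * c y" for x y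
  have c_le: "cmod (c x) \<le> opn m x" if "1 \<le> m" "x \<in> S_space" for x m
    using order_trans[OF cmod_le_snorm snorm_le_opn[OF that(2,1) unit_seq_d(1)], of 0 0]
      S_space_summable[OF that(2) unit_seq_s'_space that(1)] by (simp add: c_def unit_seq_d wt_def)
  have u_le: "cmod (u x y) \<le> opn m x * opn m y" if "1 \<le> m" "x \<in> S_space" "y \<in> S_space" for x y m
    unfolding u_def norm_mult using that c_le by (intro mult_mono opn_nonneg) auto
  have u: "cont_bilinear u"
    unfolding cont_bilinear_def
  proof (intro conjI)
    show "\<exists>n\<ge>1. \<exists>C. \<forall>x\<in>S_space. \<forall>y\<in>S_space. cmod (u x y) \<le> C * opn n x * opn n y"
      using u_le[of 1] by (intro exI[of _ 1] conjI) auto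
  qed (auto simp: u_def c_def addS_def smulS_def algebra_simps)
  have "bnorm n u \<le> 1"
    unfolding bnorm_def
  proof (rule SUP_least, clarsimp)
    fix x y assume xy: "x \<in> S_space" "y \<in> S_space" "opn n x \<le> 1" "opn n y \<le> 1"
    have "opn n x * opn n y \<le> 1" using xy opn_nonneg n by (intro mult_le_one) auto
    then show "cmod (u x y) \<le> 1" using u_le[OF n xy(1,2)] by simp
  qed
  then obtain b where b: "bnorm n u = ereal b" "0 \<le> b" "b \<le> 1"
    using bnorm_nonneg[of n u] by (cases "bnorm n u") (auto simp: one_ereal_def)
  let ?r = "rcnorm (2*n+1) (\<lambda>_. E00) 1"
  have "opn (2*n+1) (sumS (\<lambda>j. E00) 1) \<le> 1"
    using opn_E00_le[of "2*n+1"] by (simp add: sumS_def)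
  then have r: "?r \<le> 1" "0 \<le> ?r"
    using rcnorm_nonneg[of 1 "\<lambda>_. E00"] E00_S_space by (auto simp: rcnorm_def adjS_E00 E00_E00)
  have "u E00 E00 = 1" by (simp add: u_def c_def E00_def unit_seq_s'_space) (simp add: unit_seq_def)
  moreover have "ereal (cmod (\<Sum>j<1::nat. u E00 E00)) \<le> ereal C * bnorm n u * ereal ?r * ereal ?r"
    using grothendieck_constsD[OF C u, of 1 "\<lambda>_. E00" "\<lambda>_. E00"] E00_S_space by simp
  ultimately have "1 \<le> C * b * ?r * ?r" by (simp add: b(1) lessThan_Suc)
  also have "\<dots> \<le> C * 1 * 1 * 1"
    using C b r by (intro mult_mono mult_nonneg_nonneg) (auto simp: grothendieck_consts_def)
  finally show "1 \<le> C" by simp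
qed

text \<open>Gives both the positivity of \<open>K\<close> needed for extended-real products and the
  room to replace a constant 1 by \<open>K\<close>.\<close>

lemma one_le_K: "1 \<le> K"
  using one_le_Kn[of 1] Kn_le_K[of 1] by simp

text \<open>Every admissible constant dominates the ratio of the left side to \<open>b * ?t\<close>,
  hence so does their infimum. When \<open>b * ?t\<close> is 0 no ratio exists, and the admissible
  constant 2 already shows that the left side is at most 0.\<close>

lemma grothendieck_K:
  assumes u: "cont_bilinear u" and n: "1 \<le> n"
    and S: "\<And>j. j < m \<Longrightarrow> xs j \<in> S_space \<and> ys j \<in> S_space"
  shows "ereal (cmod (\<Sum>j<m. u (xs j) (ys j)))
    \<le> ereal K * bnorm n u * ereal (rcnorm (2*n+1) xs m * rcnorm (2*n+1) ys m)" (is "ereal ?L \<le> _ * _ * ereal ?t")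
proof (rule ereal_le_timesI)
  show t: "0 \<le> ?t" using S by (intro mult_nonneg_nonneg rcnorm_nonneg) auto
  show "0 < K" using one_le_K by simp
  show "?L \<le> 0" if "?t = 0" using sum_bilinear_zero[OF u n S that] by simp
  fix b assume b: "bnorm n u = ereal b"
  have b0: "0 \<le> b" using bnorm_nonneg[of n u] b by simp
  have C: "?L \<le> C * (b * ?t)" if "C \<in> grothendieck_consts n" for C
  proof -
    have "ereal ?L \<le> ereal C * bnorm n u * ereal (rcnorm (2*n+1) xs m) * ereal (rcnorm (2*n+1) ys m)"
      by (rule grothendieck_constsD[OF that u S])
    then show ?thesis by (simp add: b mult.assoc)
  qed
  have "?L \<le> Kn n * (b * ?t)"
  proof (cases "b * ?t = 0")
    case True
    then show ?thesis using C[OF two_in_grothendieck_consts[OF n]] by (simp only: mult_zero_right)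
  next
    case False
    then have "0 < b * ?t" using b0 t by (simp add: less_le)
    then have "?L / (b * ?t) \<le> Kn n"
      unfolding Kn_eq using C two_in_grothendieck_consts[OF n]
      by (intro cInf_greatest) (auto simp: pos_divide_le_eq)
    then show ?thesis using \<open>0 < b * ?t\<close> by (simp add: pos_divide_le_eq)
  qed
  also have "\<dots> \<le> K * (b * ?t)" by (intro mult_right_mono Kn_le_K n mult_nonneg_nonneg b0 t)
  finally show "?L \<le> K * b * ?t" by (simp add: mult.assoc)
qed (rule bnorm_nonneg)

section \<open>Hilbert-space valued maps\<close>

lemma hnorm_nonneg:
  assumes "frechet_hilbert smul ip"
  shows "0 \<le> hnorm ip k a"
proof -
  have "0 \<le> Re (ip k a a)" using assms unfolding frechet_hilbert_def by blast
  then show ?thesis by (simp add: hnorm_def)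
qed

text \<open>The form is only semidefinite, so the product of b with itself may vanish for nonzero b;
  then t is taken arbitrarily large, and otherwise it is the reciprocal of that product.\<close>

lemma frechet_hilbert_Cauchy_Schwarz:
  assumes "frechet_hilbert smul ip"
  shows "cmod (ip k a b) \<le> hnorm ip k a * hnorm ip k b"
proof -
  have add: "ip k (x + y) z = ip k x z + ip k y z" and scale: "ip k (smul c x) z = c * ip k x z"
    and herm: "ip k y x = cnj (ip k x y)" and pos: "0 \<le> Re (ip k x x)" for x y z c
    using assms unfolding frechet_hilbert_def by blast+
  define z where "z = ip k a b"
  have key: "2 * t * (cmod z)\<^sup>2 \<le> Re (ip k a a) + t\<^sup>2 * (cmod z)\<^sup>2 * Re (ip k b b)" for t :: real
  proof -
    \<comment> \<open>The factor z aligns the phases, so that both cross terms become -t times the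
      squared modulus of z.\<close>
    define l where "l = - complex_of_real t * z"
    have "ip k a (smul l b) = cnj l * z" using scale[of l b a] herm[of a "smul l b"] herm[of a b] by (simp add: z_def)
    moreover have "ip k (smul l b) a = l * cnj z" using scale[of l b a] herm[of a b] by (simp add: z_def)
    moreover have "ip k (smul l b) (smul l b) = l * cnj l * ip k b b"
      using scale[of l b "smul l b"] scale[of l b b] herm[of b "smul l b"] herm[of b b] by simp
    moreover have "ip k a (a + smul l b) = ip k a a + ip k a (smul l b)"
      "ip k (smul l b) (a + smul l b) = ip k (smul l b) a + ip k (smul l b) (smul l b)"
      using add[of a "smul l b" a] add[of a "smul l b" "smul l b"] herm
      by (metis complex_cnj_add)+
    ultimately have "ip k (a + smul l b) (a + smul l b) = ip k a a + cnj l * z + l * cnj z + l * cnj l * ip k b b"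
      by (simp add: add)
    also have "Re \<dots> = Re (ip k a a) - 2 * t * (cmod z)\<^sup>2 + t\<^sup>2 * (cmod z)\<^sup>2 * Re (ip k b b)"
      unfolding l_def cmod_power2 by (simp add: power2_eq_square algebra_simps)
    finally show ?thesis using pos[of "a + smul l b"] by simp
  qed
  have "(cmod z)\<^sup>2 \<le> Re (ip k a a) * Re (ip k b b)"
  proof (cases "Re (ip k b b) = 0")
    case True
    have "(cmod z)\<^sup>2 \<le> 0"
      using key True by (intro le_zero_if_scaled_le[of _ "Re (ip k a a) / 2"]) (simp add: field_simps)
    then show ?thesis using True by simp
  next
    case False
    then have "0 < Re (ip k b b)" using pos[of b] by simp
    then show ?thesis using key[of "1 / Re (ip k b b)"] by (simp add: field_simps power2_eq_square)
  qed
  then show ?thesis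
    unfolding hnorm_def z_def by (simp add: real_le_rsqrt flip: real_sqrt_mult)
qed

text \<open>The semi-inner product is conjugate-linear in its second argument and so is the
  involution; composing the two gives a form linear in y.\<close>

lemma cont_bilinear_ip:
  assumes H: "frechet_hilbert smul ip"
    and u1: "cont_linear_S smul ip u1" and u2: "cont_linear_S smul ip u2"
  shows "cont_bilinear (\<lambda>x y. ip k (u1 x) (u2 (adjS y)))"
proof -
  have add: "ip k (x + y) z = ip k x z + ip k y z" and scale: "ip k (smul c x) z = c * ip k x z"
    and herm: "ip k y x = cnj (ip k x y)" for x y z c
    using H unfolding frechet_hilbert_def by blast+
  have add': "ip k z (x + y) = ip k z x + ip k z y" for x y z
    using arg_cong[OF add[of x y z], of cnj] by (simp flip: herm)
  have scale': "ip k z (smul c x) = cnj c * ip k z x" for x z c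
    using arg_cong[OF scale[of c x z], of cnj] by (simp flip: herm)
  have lin: "u1 (addS x y) = u1 x + u1 y" "u2 (addS x y) = u2 x + u2 y"
    if "x \<in> S_space" "y \<in> S_space" for x y
    using u1 u2 that unfolding cont_linear_S_def by blast+
  have lin': "u1 (smulS c x) = smul c (u1 x)" "u2 (smulS c x) = smul c (u2 x)" if "x \<in> S_space" for x c
    using u1 u2 that unfolding cont_linear_S_def by blast+
  obtain n1 C1 where n1: "1 \<le> n1" "\<And>x. x \<in> S_space \<Longrightarrow> hnorm ip k (u1 x) \<le> C1 * opn n1 x"
    using u1 unfolding cont_linear_S_def by blast
  obtain n2 C2 where n2: "1 \<le> n2" "\<And>x. x \<in> S_space \<Longrightarrow> hnorm ip k (u2 x) \<le> C2 * opn n2 x"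
    using u2 unfolding cont_linear_S_def by blast
  define N where "N = max n1 n2"
  have N: "1 \<le> N" using n1 by (simp add: N_def)
  note hn = hnorm_nonneg[OF H]
  have h1: "hnorm ip k (u1 x) \<le> \<bar>C1\<bar> * opn N x" if "x \<in> S_space" for x
    using n1(2)[OF that] mult_mono[of C1 "\<bar>C1\<bar>" "opn n1 x" "opn N x"] opn_mono[OF that n1(1), of N]
      opn_nonneg[OF that n1(1)] abs_ge_self[of C1] by (simp add: N_def)
  have h2: "hnorm ip k (u2 (adjS x)) \<le> \<bar>C2\<bar> * opn N x" if "x \<in> S_space" for x
  proof -
    have "opn n2 (adjS x) \<le> opn N x"
      using opn_adjS_le[OF that n2(1)] opn_mono[OF that n2(1), of N] by (simp add: N_def)
    then show ?thesis
      using n2(2)[OF adjS_S_space[OF that]] mult_mono[of C2 "\<bar>C2\<bar>" "opn n2 (adjS x)" "opn N x"]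
        opn_nonneg[OF adjS_S_space[OF that] n2(1)] abs_ge_self[of C2] by simp
  qed
  have bound: "cmod (ip k (u1 x) (u2 (adjS y))) \<le> \<bar>C1\<bar> * \<bar>C2\<bar> * opn N x * opn N y"
    if "x \<in> S_space" "y \<in> S_space" for x y
  proof -
    have "cmod (ip k (u1 x) (u2 (adjS y))) \<le> hnorm ip k (u1 x) * hnorm ip k (u2 (adjS y))"
      by (rule frechet_hilbert_Cauchy_Schwarz[OF H])
    also have "\<dots> \<le> (\<bar>C1\<bar> * opn N x) * (\<bar>C2\<bar> * opn N y)"
      using that by (intro mult_mono h1 h2 mult_nonneg_nonneg opn_nonneg N hn) auto
    finally show ?thesis by (simp add: algebra_simps)
  qed
  show ?thesis
    unfolding cont_bilinear_def
  proof (intro conjI)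
    show "\<exists>n\<ge>1. \<exists>C. \<forall>x\<in>S_space. \<forall>y\<in>S_space. cmod (ip k (u1 x) (u2 (adjS y))) \<le> C * opn n x * opn n y"
      using N bound by blast
  qed (auto simp: adjS_addS adjS_smulS adjS_S_space lin lin' add add' scale scale')
qed

lemma bnorm_ip_le:
  assumes H: "frechet_hilbert smul ip" and n: "1 \<le> n"
  shows "bnorm n (\<lambda>x y. ip k (u1 x) (u2 (adjS y))) \<le> opnormH ip u1 n k * opnormH ip u2 n k"
  unfolding bnorm_def
proof (rule SUP_least, clarsimp)
  fix x y assume xy: "x \<in> S_space" "y \<in> S_space" "opn n x \<le> 1" "opn n y \<le> 1"
  note hn = hnorm_nonneg[OF H]
  have "ereal (hnorm ip k (u1 x)) \<le> opnormH ip u1 n k" "ereal (hnorm ip k (u2 (adjS y))) \<le> opnormH ip u2 n k"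
    unfolding opnormH_def using xy order_trans[OF opn_adjS_le[OF xy(2) n] xy(4)]
    by (auto intro!: SUP_upper adjS_S_space)
  then have "ereal (hnorm ip k (u1 x)) * ereal (hnorm ip k (u2 (adjS y))) \<le> opnormH ip u1 n k * opnormH ip u2 n k"
    using hn order_trans[of 0 "ereal (hnorm ip k (u1 x))"] by (intro ereal_mult_mono) auto
  then show "ereal (cmod (ip k (u1 x) (u2 (adjS y)))) \<le> opnormH ip u1 n k * opnormH ip u2 n k"
    using frechet_hilbert_Cauchy_Schwarz[OF H, of k "u1 x" "u2 (adjS y)"]
    by (metis ereal_less_eq(3) order_trans times_ereal.simps(1))
qed

section \<open>The inequality for maps into a Frechet-Hilbert space, for families and with
  states\<close>

theorem theorem4p2:
  fixes smul :: "complex \<Rightarrow> 'h::ab_group_add \<Rightarrow> 'h"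
    and ip :: "nat \<Rightarrow> 'h \<Rightarrow> 'h \<Rightarrow> complex"
    and u1 u2 :: "opS \<Rightarrow> 'h"
  assumes H: "frechet_hilbert smul ip"
    and u1: "cont_linear_S smul ip u1"
    and u2: "cont_linear_S smul ip u2"
  shows "(\<forall>k m n (xs :: nat \<Rightarrow> opS) (ys :: nat \<Rightarrow> opS). n \<ge> 1 \<longrightarrow>
            (\<forall>j<m. xs j \<in> S_space \<and> ys j \<in> S_space) \<longrightarrow>
            ereal (cmod (\<Sum>j<m. ip k (u1 (xs j)) (u2 (ys j))))
              \<le> ereal K * opnormH ip u1 n k * opnormH ip u2 n k
                 * ereal (rcnorm (2*n+1) xs m) * ereal (rcnorm (2*n+1) ys m))
       \<and> (\<forall>k n. n \<ge> 1 \<longrightarrow> (\<exists>\<phi>1 \<phi>2 \<psi>1 \<psi>2.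
            nstate (2*n+1) \<phi>1 \<and> nstate (2*n+1) \<phi>2 \<and> nstate (2*n+1) \<psi>1 \<and> nstate (2*n+1) \<psi>2 \<and>
            (\<forall>x\<in>S_space. \<forall>y\<in>S_space.
               ereal (cmod (ip k (u1 x) (u2 y)))
                 \<le> ereal K * opnormH ip u1 n k * opnormH ip u2 n k
                    * ereal (sqrt (Re (\<phi>1 (mulS (adjS x) x) + \<phi>2 (mulS x (adjS x)))))
                    * ereal (sqrt (Re (\<psi>1 (mulS (adjS y) y) + \<psi>2 (mulS y (adjS y))))))))"
proof (intro conjI allI impI)
  fix k m n :: nat and xs ys :: "nat \<Rightarrow> opS"
  assume n: "1 \<le> n" and S: "\<forall>j<m. xs j \<in> S_space \<and> ys j \<in> S_space"
  let ?u = "\<lambda>x y. ip k (u1 x) (u2 (adjS y))"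
  let ?r = "rcnorm (2*n+1) xs m" and ?s = "rcnorm (2*n+1) ys m"
  have s: "rcnorm (2*n+1) (\<lambda>j. adjS (ys j)) m = ?s" using S by (intro rcnorm_adjS) auto
  have rs: "0 \<le> ?r" "0 \<le> ?s" using S by (auto intro!: rcnorm_nonneg)
  \<comment> \<open>Inserting the adjoints of the \<open>ys\<close> cancels the involution inside
    \<open>?u\<close>, and by \<open>s\<close> it leaves the rc-norm unchanged.\<close>
  have "ereal (cmod (\<Sum>j<m. ?u (xs j) (adjS (ys j)))) \<le> ereal K * bnorm n ?u * ereal (?r * ?s)"
    using grothendieck_K[OF cont_bilinear_ip[OF H u1 u2] n, of m xs "\<lambda>j. adjS (ys j)" k, unfolded s] S
    by (simp add: adjS_S_space)
  also have "(\<Sum>j<m. ?u (xs j) (adjS (ys j))) = (\<Sum>j<m. ip k (u1 (xs j)) (u2 (ys j)))"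
    using S by (simp add: adjS_adjS)
  also have "ereal K * bnorm n ?u * ereal (?r * ?s)
      \<le> ereal K * (opnormH ip u1 n k * opnormH ip u2 n k) * ereal (?r * ?s)"
    using one_le_K rs bnorm_ip_le[OF H n, of k u1 u2]
    by (intro ereal_mult_right_mono ereal_mult_left_mono) auto
  finally show "ereal (cmod (\<Sum>j<m. ip k (u1 (xs j)) (u2 (ys j))))
      \<le> ereal K * opnormH ip u1 n k * opnormH ip u2 n k * ereal ?r * ereal ?s"
    by (simp add: mult.assoc)
next
  fix k n :: nat assume n: "1 \<le> n"
  let ?u = "\<lambda>x y. ip k (u1 x) (u2 (adjS y))"
  let ?h = "opnormH ip u1 n k * opnormH ip u2 n k"
  let ?A = "\<lambda>x. sqrt (Re (hs_state n (mulS (adjS x) x) + hs_state n (mulS x (adjS x))))"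
  note u = cont_bilinear_ip[OF H u1 u2, of k]
  have bound: "ereal (cmod (ip k (u1 x) (u2 y)))
      \<le> ereal K * opnormH ip u1 n k * opnormH ip u2 n k * ereal (?A x) * ereal (?A y)"
    if x: "x \<in> S_space" and y: "y \<in> S_space" for x y
  proof -
    note y' = adjS_S_space[OF y]
    have opn_le: "opn n z \<le> ?A z" if "z \<in> S_space" for z
      by (rule real_le_rsqrt[OF opn_sq_le_hs_state[OF that n]])
    note x0 = opn_nonneg[OF x n] and y0 = opn_nonneg[OF y n] and y'0 = opn_nonneg[OF y' n]
    have A: "0 \<le> ?A x" "0 \<le> ?A y" using x0 y0 opn_le[OF x] opn_le[OF y] by linarith+
    \<comment> \<open>Keeping the two operator norms together as the single factor \<open>?h\<close>
      lets \<open>ereal_le_timesI\<close> treat finite and infinite values at once.\<close>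
    have "ereal (cmod (?u x (adjS y))) \<le> ereal K * ?h * ereal (?A x * ?A y)"
    proof (rule ereal_le_timesI)
      show "0 < K" using one_le_K by simp
      show "0 \<le> ?h" using bnorm_nonneg bnorm_ip_le[OF H n] by (rule order_trans)
      show "0 \<le> ?A x * ?A y" using A by (rule mult_nonneg_nonneg)
      show "cmod (?u x (adjS y)) \<le> 0" if "?A x * ?A y = 0"
      proof -
        have "?A x = 0 \<or> ?A y = 0" using that by (simp only: mult_eq_0_iff)
        then have "opn n x = 0 \<or> opn n (adjS y) = 0"
          using opn_le[OF x] opn_le[OF y] x0 y'0 opn_adjS_le[OF y n] by linarith
        from cont_bilinear_zero[OF u x y' n this] show ?thesis by simp
      qed
      fix \<gamma> assume \<gamma>: "?h = ereal \<gamma>"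
      have \<gamma>0: "0 \<le> \<gamma>" using order_trans[OF bnorm_nonneg bnorm_ip_le[OF H n, of k u1 u2]] \<gamma> by simp
      have "cmod (?u x (adjS y)) \<le> \<gamma> * opn n x * opn n (adjS y)"
        using bnorm_ip_le[OF H n, of k u1 u2] \<gamma> by (intro cont_bilinear_bound[OF u _ n x y']) simp
      \<comment> \<open>The adjoint of y is compared with y in norm first, so the same square-root
        expression serves for both arguments.\<close>
      also have "\<dots> \<le> \<gamma> * ?A x * ?A y"
        by (intro mult_mono order_trans[OF opn_adjS_le[OF y n]] opn_le x y mult_nonneg_nonneg order_refl \<gamma>0 x0 y'0 A)
      also have "\<dots> = 1 * (\<gamma> * (?A x * ?A y))" by simp
      also have "\<dots> \<le> K * (\<gamma> * (?A x * ?A y))"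
        by (intro mult_right_mono one_le_K mult_nonneg_nonneg \<gamma>0 A)
      finally show "cmod (?u x (adjS y)) \<le> K * \<gamma> * (?A x * ?A y)" by (simp only: mult.assoc)
    qed
    then show ?thesis by (simp add: adjS_adjS y mult.assoc flip: times_ereal.simps(1))
  qed
  show "\<exists>\<phi>1 \<phi>2 \<psi>1 \<psi>2.
      nstate (2*n+1) \<phi>1 \<and> nstate (2*n+1) \<phi>2 \<and> nstate (2*n+1) \<psi>1 \<and> nstate (2*n+1) \<psi>2 \<and>
      (\<forall>x\<in>S_space. \<forall>y\<in>S_space.
         ereal (cmod (ip k (u1 x) (u2 y)))
           \<le> ereal K * opnormH ip u1 n k * opnormH ip u2 n k
              * ereal (sqrt (Re (\<phi>1 (mulS (adjS x) x) + \<phi>2 (mulS x (adjS x)))))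
              * ereal (sqrt (Re (\<psi>1 (mulS (adjS y) y) + \<psi>2 (mulS y (adjS y))))))"
    using nstate_hs_state[of n] bound
    by (intro exI[of _ "hs_state n"] conjI ballI)
qed

end
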